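(* Let $\mathbf C$ be a cubical $\omega$-category, $A\in\mathbf C_n$ with $n\ge2$, and $1\le i<n$. Then $A$ is $T_i$-invertible if and only if $A$ is invertible and has a $T_i$-invertible shell.
   Context: Index notation: for positive integers $i,j$, $j^i=j$ if $j<i$ and $j^i=j+1$ if $j\ge i$; for $j\neq i$, $j_i=j$ if $j<i$ and $j_i=j-1$ if $j>i$. Cubical $\omega$-categories (always with connections): a cubical $\omega$-category $\mathbf C$ consists of sets $\mathbf C_n$ ($n\ge0$), maps $\partial_i^\alpha:\mathbf C_n\to\mathbf C_{n-1}$ and $\Gamma_i^\alpha:\mathbf C_n\to\mathbf C_{n+1}$ ($n\ge1$, $1\le i\le n$, $\alpha=\pm$), maps $\epsilon_i:\mathbf C_n\to\mathbf C_{n+1}$ ($n\ge0$, $1\le i\le n+1$), and partial operations $\star_i$ on $\mathbf C_n$ ($1\le i\le n$), with $A\star_iB$ defined exactly when $\partial_i^+A=\partial_i^-B$, subject to (for all indices and cells for which both sides make sense): - $\partial_{j-1}^\alpha\partial_i^\beta=\partial_i^\beta\partial_j^\alpha$ for $i<j$; - $\partial_i^\alpha\epsilon_j=\epsilon_{j_i}\partial_{i_j}^\alpha$ for $i\ne j$, and $\partial_i^\alpha\epsilon_i=\mathrm{id}$; - $\partial_i^\alpha\Gamma_j^\beta=\Gamma_{j_i}^\beta\partial_{i_j}^\alpha$ for $i\ne j,j+1$; for $i\in\{j,j+1\}$, $\partial_i^\alpha\Gamma_j^\alpha=\mathrm{id}$ and $\partial_i^\alpha\Gamma_j^{-\alpha}=\epsilon_j\partial_j^\alpha$;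 - $\epsilon_i\epsilon_j=\epsilon_{j+1}\epsilon_i$ for $i\le j$; $\Gamma_i^\alpha\Gamma_j^\beta=\Gamma_{j+1}^\beta\Gamma_i^\alpha$ for $i<j$; $\Gamma_{i+1}^\alpha\Gamma_i^\alpha=\Gamma_i^\alpha\Gamma_i^\alpha$; $\Gamma_i^\alpha\epsilon_j=\epsilon_{j^i}\Gamma_{i_j}^\alpha$ for $i\ne j$; $\Gamma_i^\alpha\epsilon_i=\epsilon_i\epsilon_i$; - $\partial_i^\alpha(A\star_jB)=\partial_i^\alpha A\star_{j_i}\partial_i^\alpha B$ for $i\neq j$; $\partial_i^-(A\star_iB)=\partial_i^-A$; $\partial_i^+(A\star_iB)=\partial_i^+B$; - $\star_i$ is associative; $A\star_i\epsilon_i\partial_i^+A=\epsilon_i\partial_i^-A\star_iA=A$; $(A\star_iB)\star_j(C\star_iD)=(A\star_jC)\star_i(B\star_jD)$ for $i\neq j$; - $\epsilon_i(A\star_jB)=\epsilon_iA\star_{j^i}\epsilon_iB$; $\Gamma_i^\alpha(A\star_jB)=\Gamma_i^\alpha A\star_{j^i}\Gamma_i^\alpha B$ for $i\ne j$; $\Gamma_i^-(A\star_iB)=(\Gamma_i^-A\star_i\epsilon_{i+1}B)\star_{i+1}(\epsilon_iB\star_i\Gamma_i^-B)$; $\Gamma_i^+(A\star_iB)=(\Gamma_i^+A\star_i\epsilon_iA)\star_{i+1}(\epsilon_{i+1}A\star_i\Gamma_i^+B)$; - $\Gamma_i^+A\star_i\Gamma_i^-A=\epsilon_{i+1}A$;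 $\Gamma_i^+A\star_{i+1}\Gamma_i^-A=\epsilon_iA$. A cubical $n$-category is the same structure restricted to dimensions $\le n$; $\mathrm{tr}_n\mathbf C$ denotes the truncation of $\mathbf C$ to dimensions $\le n$. Plain invertibility. $A\in\mathbf C_n$ is $R_1$-invertible ($n\ge1$) if there is $B\in\mathbf C_n$ with $A\star_1B=\epsilon_1\partial_1^-A$ and $B\star_1A=\epsilon_1\partial_1^+A$. For $1\le i\le n-1$ put $\psi_iA=\Gamma_i^+\partial_{i+1}^-A\star_{i+1}A\star_{i+1}\Gamma_i^-\partial_{i+1}^+A$. A cell $A\in\mathbf C_n$ ($n\ge1$) is invertible if $\psi_1\cdots\psi_{n-1}A$ is $R_1$-invertible. $T_i$-invertibility. For $1\le i<n$, $A\in\mathbf C_n$ is $T_i$-invertible with $T_i$-inverse $B\in\mathbf C_n$ (written $T_iA$; it is unique) if $\partial_i^\alpha A=\partial_{i+1}^\alpha B$ and $\partial_{i+1}^\alpha A=\partial_i^\alpha B$ for $\alpha=\pm$, and $(\Gamma_i^+\partial_{i+1}^-A\star_iB)\star_{i+1}(A\star_i\Gamma_i^-\partial_i^+A)=\Gamma_i^-\partial_i^-A\star_i\Gamma_i^+\partial_{i+1}^+A$, together with the same equation with $A$ and $B$ exchanged. The same definition applies in cubical $n$-categories. Shells. For a cubical $n$-category $\mathbf C$, $\Box\mathbf C$ is the cubical $(n+1)$-category equal to $\mathbf C$ in dimensions $\le n$, whose $(n+1)$-cells are the families $A=(A_i^\alpha)_{1\le i\le n+1,\alpha=\pm}$ of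 $n$-cells with $\partial_{i_j}^\alpha A_j^\beta=\partial_{j_i}^\beta A_i^\alpha$ for $i\ne j$, with $\partial_i^\alpha A=A_i^\alpha$; for $A\in\mathbf C_n$, $\epsilon_iA$ and $\Gamma_i^\alpha A$ in dimension $n+1$ are the families of faces prescribed by the axioms above; $(A\star_iB)_i^-=A_i^-$, $(A\star_iB)_i^+=B_i^+$, $(A\star_iB)_j^\alpha=A_j^\alpha\star_{i_j}B_j^\alpha$ for $j\neq i$. For a cubical $\omega$-category $\mathbf C$ and $A\in\mathbf C_n$ ($n\ge1$), the shell of $A$ is $\boldsymbol\partial A=(\partial_i^\alpha A)$, an $n$-cell of $\Box\,\mathrm{tr}_{n-1}\mathbf C$; $A$ has a $T_i$-invertible shell if $\boldsymbol\partial A$ is $T_i$-invertible in $\Box\,\mathrm{tr}_{n-1}\mathbf C$. *)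

theory Defs
  imports "HOL-Library.FuncSet" "HOL-Library.Extended_Nat"
begin

text \<open>\<^term>\<open>up i j\<close> is $j^i$ and \<^term>\<open>down i j\<close> is $j_i$ (the latter is only used for \<^prop>\<open>j \<noteq> i\<close>).\<close>

definition up :: "nat \<Rightarrow> nat \<Rightarrow> nat" where
  "up i j = (if j < i then j else j + 1)"

definition down :: "nat \<Rightarrow> nat \<Rightarrow> nat" where
  "down i j = (if j < i then j else j - 1)"

datatype sign = Minus | Plus

text \<open>
  All cells live in one type, and the sets of cells of distinct dimensions need not be disjoint, so
  every operation takes as its first argument the dimension \<open>n\<close> of the cells it is applied to:
  \<open>face C n i \<alpha>\<close> is $\partial_i^\alpha : C_n \to C_{n-1}$,
  \<open>degen C n i\<close> is $\epsilon_i : C_n \to C_{n+1}$,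
  \<open>conn C n i \<alpha>\<close> is $\Gamma_i^\alpha : C_n \to C_{n+1}$, and
  \<open>cmp C n i\<close> is $\star_i$ on $C_n$.  The operations are total functions; their values are
  meaningless outside the index ranges, the cells, and (for \<open>cmp\<close>) the composable pairs.
\<close>

record 'a cubical_data =
  cells :: "nat \<Rightarrow> 'a set"
  face :: "nat \<Rightarrow> nat \<Rightarrow> sign \<Rightarrow> 'a \<Rightarrow> 'a"
  degen :: "nat \<Rightarrow> nat \<Rightarrow> 'a \<Rightarrow> 'a"
  conn :: "nat \<Rightarrow> nat \<Rightarrow> sign \<Rightarrow> 'a \<Rightarrow> 'a"
  cmp :: "nat \<Rightarrow> nat \<Rightarrow> 'a \<Rightarrow> 'a \<Rightarrow> 'a"

definition composable :: "'a cubical_data \<Rightarrow> nat \<Rightarrow> nat \<Rightarrow> 'a \<Rightarrow> 'a \<Rightarrow> bool" where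
  "composable C n i A B \<longleftrightarrow>
     A \<in> cells C n \<and> B \<in> cells C n \<and> 1 \<le> i \<and> i \<le> n \<and> face C n i Plus A = face C n i Minus B"

text \<open>
  Cubical \<open>N\<close>-categories with connections.  The bound \<open>N\<close> is an extended natural number:
  \<open>N = \<infinity>\<close> gives cubical \<open>\<omega>\<close>-categories.  Each axiom is required only when all the dimensions
  occurring in it are at most \<open>N\<close>.
\<close>

locale cubical_category =
  fixes N :: enat and C :: "'a cubical_data"
  assumes face_closed:
    "\<And>n i \<alpha> A. \<lbrakk>enat n \<le> N; 1 \<le> i; i \<le> n; A \<in> cells C n\<rbrakk>
      \<Longrightarrow> face C n i \<alpha> A \<in> cells C (n - 1)"
  and degen_closed:
    "\<And>n i A. \<lbrakk>enat (n + 1) \<le> N; 1 \<le> i; i \<le> n + 1; A \<in> cells C n\<rbrakk>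
      \<Longrightarrow> degen C n i A \<in> cells C (n + 1)"
  and conn_closed:
    "\<And>n i \<alpha> A. \<lbrakk>enat (n + 1) \<le> N; 1 \<le> i; i \<le> n; A \<in> cells C n\<rbrakk>
      \<Longrightarrow> conn C n i \<alpha> A \<in> cells C (n + 1)"
  and cmp_closed:
    "\<And>n i A B. \<lbrakk>enat n \<le> N; composable C n i A B\<rbrakk> \<Longrightarrow> cmp C n i A B \<in> cells C n"
  and face_face:
    "\<And>n i j \<alpha> \<beta> A. \<lbrakk>enat n \<le> N; 1 \<le> i; i < j; j \<le> n; A \<in> cells C n\<rbrakk>
      \<Longrightarrow> face C (n - 1) (j - 1) \<alpha> (face C n i \<beta> A) = face C (n - 1) i \<beta> (face C n j \<alpha> A)"
  and face_degen:
    "\<And>n i j \<alpha> A. \<lbrakk>enat (n + 1) \<le> N; 1 \<le> i; i \<le> n + 1; 1 \<le> j; j \<le> n + 1; i \<noteq> j; A \<in> cells C n\<rbrakk>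
      \<Longrightarrow> face C (n + 1) i \<alpha> (degen C n j A) = degen C (n - 1) (down i j) (face C n (down j i) \<alpha> A)"
  and face_degen_same:
    "\<And>n i \<alpha> A. \<lbrakk>enat (n + 1) \<le> N; 1 \<le> i; i \<le> n + 1; A \<in> cells C n\<rbrakk>
      \<Longrightarrow> face C (n + 1) i \<alpha> (degen C n i A) = A"
  and face_conn:
    "\<And>n i j \<alpha> \<beta> A. \<lbrakk>enat (n + 1) \<le> N; 1 \<le> i; i \<le> n + 1; 1 \<le> j; j \<le> n; i \<noteq> j; i \<noteq> j + 1;
       A \<in> cells C n\<rbrakk>
      \<Longrightarrow> face C (n + 1) i \<alpha> (conn C n j \<beta> A) = conn C (n - 1) (down i j) \<beta> (face C n (down j i) \<alpha> A)"
  and face_conn_same: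
    "\<And>n i j \<alpha> A. \<lbrakk>enat (n + 1) \<le> N; 1 \<le> j; j \<le> n; i = j \<or> i = j + 1; A \<in> cells C n\<rbrakk>
      \<Longrightarrow> face C (n + 1) i \<alpha> (conn C n j \<alpha> A) = A"
  and face_conn_opposite:
    "\<And>n i j \<alpha> \<beta> A. \<lbrakk>enat (n + 1) \<le> N; 1 \<le> j; j \<le> n; i = j \<or> i = j + 1; \<beta> \<noteq> \<alpha>; A \<in> cells C n\<rbrakk>
      \<Longrightarrow> face C (n + 1) i \<alpha> (conn C n j \<beta> A) = degen C (n - 1) j (face C n j \<alpha> A)"
  and degen_degen:
    "\<And>n i j A. \<lbrakk>enat (n + 2) \<le> N; 1 \<le> i; i \<le> j; j \<le> n + 1; A \<in> cells C n\<rbrakk>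
      \<Longrightarrow> degen C (n + 1) i (degen C n j A) = degen C (n + 1) (j + 1) (degen C n i A)"
  and conn_conn:
    "\<And>n i j \<alpha> \<beta> A. \<lbrakk>enat (n + 2) \<le> N; 1 \<le> i; i < j; j \<le> n; A \<in> cells C n\<rbrakk>
      \<Longrightarrow> conn C (n + 1) i \<alpha> (conn C n j \<beta> A) = conn C (n + 1) (j + 1) \<beta> (conn C n i \<alpha> A)"
  and conn_conn_same:
    "\<And>n i \<alpha> A. \<lbrakk>enat (n + 2) \<le> N; 1 \<le> i; i \<le> n; A \<in> cells C n\<rbrakk>
      \<Longrightarrow> conn C (n + 1) (i + 1) \<alpha> (conn C n i \<alpha> A) = conn C (n + 1) i \<alpha> (conn C n i \<alpha> A)"
  and conn_degen:
    "\<And>n i j \<alpha> A. \<lbrakk>enat (n + 2) \<le> N; 1 \<le> i; i \<le> n + 1; 1 \<le> j; j \<le> n + 1; i \<noteq> j; A \<in> cells C n\<rbrakk>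
      \<Longrightarrow> conn C (n + 1) i \<alpha> (degen C n j A) = degen C (n + 1) (up i j) (conn C n (down j i) \<alpha> A)"
  and conn_degen_same:
    "\<And>n i \<alpha> A. \<lbrakk>enat (n + 2) \<le> N; 1 \<le> i; i \<le> n + 1; A \<in> cells C n\<rbrakk>
      \<Longrightarrow> conn C (n + 1) i \<alpha> (degen C n i A) = degen C (n + 1) i (degen C n i A)"
  and face_cmp:
    "\<And>n i j \<alpha> A B. \<lbrakk>enat n \<le> N; 1 \<le> i; i \<le> n; i \<noteq> j; composable C n j A B\<rbrakk>
      \<Longrightarrow> face C n i \<alpha> (cmp C n j A B) = cmp C (n - 1) (down i j) (face C n i \<alpha> A) (face C n i \<alpha> B)"
  and face_cmp_minus:
    "\<And>n i A B. \<lbrakk>enat n \<le> N; composable C n i A B\<rbrakk>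
      \<Longrightarrow> face C n i Minus (cmp C n i A B) = face C n i Minus A"
  and face_cmp_plus:
    "\<And>n i A B. \<lbrakk>enat n \<le> N; composable C n i A B\<rbrakk>
      \<Longrightarrow> face C n i Plus (cmp C n i A B) = face C n i Plus B"
  and cmp_assoc:
    "\<And>n i A B D. \<lbrakk>enat n \<le> N; composable C n i A B; composable C n i B D\<rbrakk>
      \<Longrightarrow> cmp C n i (cmp C n i A B) D = cmp C n i A (cmp C n i B D)"
  and cmp_unit_right:
    "\<And>n i A. \<lbrakk>enat n \<le> N; 1 \<le> i; i \<le> n; A \<in> cells C n\<rbrakk>
      \<Longrightarrow> cmp C n i A (degen C (n - 1) i (face C n i Plus A)) = A"
  and cmp_unit_left:
    "\<And>n i A. \<lbrakk>enat n \<le> N; 1 \<le> i; i \<le> n; A \<in> cells C n\<rbrakk>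
      \<Longrightarrow> cmp C n i (degen C (n - 1) i (face C n i Minus A)) A = A"
  and interchange:
    "\<And>n i j A B D E. \<lbrakk>enat n \<le> N; i \<noteq> j; composable C n i A B; composable C n i D E;
       composable C n j A D; composable C n j B E\<rbrakk>
      \<Longrightarrow> cmp C n j (cmp C n i A B) (cmp C n i D E) = cmp C n i (cmp C n j A D) (cmp C n j B E)"
  and degen_cmp:
    "\<And>n i j A B. \<lbrakk>enat (n + 1) \<le> N; 1 \<le> i; i \<le> n + 1; composable C n j A B\<rbrakk>
      \<Longrightarrow> degen C n i (cmp C n j A B) = cmp C (n + 1) (up i j) (degen C n i A) (degen C n i B)"
  and conn_cmp:
    "\<And>n i j \<alpha> A B. \<lbrakk>enat (n + 1) \<le> N; 1 \<le> i; i \<le> n; i \<noteq> j; composable C n j A B\<rbrakk>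
      \<Longrightarrow> conn C n i \<alpha> (cmp C n j A B) = cmp C (n + 1) (up i j) (conn C n i \<alpha> A) (conn C n i \<alpha> B)"
  and conn_minus_cmp:
    "\<And>n i A B. \<lbrakk>enat (n + 1) \<le> N; composable C n i A B\<rbrakk>
      \<Longrightarrow> conn C n i Minus (cmp C n i A B) =
          cmp C (n + 1) (i + 1)
            (cmp C (n + 1) i (conn C n i Minus A) (degen C n (i + 1) B))
            (cmp C (n + 1) i (degen C n i B) (conn C n i Minus B))"
  and conn_plus_cmp:
    "\<And>n i A B. \<lbrakk>enat (n + 1) \<le> N; composable C n i A B\<rbrakk>
      \<Longrightarrow> conn C n i Plus (cmp C n i A B) =
          cmp C (n + 1) (i + 1)
            (cmp C (n + 1) i (conn C n i Plus A) (degen C n i A))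
            (cmp C (n + 1) i (degen C n (i + 1) A) (conn C n i Plus B))"
  and cmp_conn_conn:
    "\<And>n i A. \<lbrakk>enat (n + 1) \<le> N; 1 \<le> i; i \<le> n; A \<in> cells C n\<rbrakk>
      \<Longrightarrow> cmp C (n + 1) i (conn C n i Plus A) (conn C n i Minus A) = degen C n (i + 1) A"
  and cmp_conn_conn_next:
    "\<And>n i A. \<lbrakk>enat (n + 1) \<le> N; 1 \<le> i; i \<le> n; A \<in> cells C n\<rbrakk>
      \<Longrightarrow> cmp C (n + 1) (i + 1) (conn C n i Plus A) (conn C n i Minus A) = degen C n i A"

abbreviation cubical_omega_category :: "'a cubical_data \<Rightarrow> bool" where
  "cubical_omega_category C \<equiv> cubical_category \<infinity> C"

definition truncation :: "nat \<Rightarrow> 'a cubical_data \<Rightarrow> 'a cubical_data" where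
  "truncation n C = C\<lparr>cells := (\<lambda>m. if m \<le> n then cells C m else {})\<rparr>"

definition R1_invertible :: "'a cubical_data \<Rightarrow> nat \<Rightarrow> 'a \<Rightarrow> bool" where
  "R1_invertible C n A \<longleftrightarrow>
     (\<exists>B. composable C n 1 A B \<and> composable C n 1 B A \<and>
          cmp C n 1 A B = degen C (n - 1) 1 (face C n 1 Minus A) \<and>
          cmp C n 1 B A = degen C (n - 1) 1 (face C n 1 Plus A))"

text \<open>The composites in the next definition are always defined, by \<open>face_conn_same\<close>.\<close>

definition psi :: "'a cubical_data \<Rightarrow> nat \<Rightarrow> nat \<Rightarrow> 'a \<Rightarrow> 'a" where
  "psi C n i A =
     cmp C n (i + 1)
       (cmp C n (i + 1) (conn C (n - 1) i Plus (face C n (i + 1) Minus A)) A)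
       (conn C (n - 1) i Minus (face C n (i + 1) Plus A))"

text \<open>The \<open>foldr\<close> below is $\psi_1 \cdots \psi_{n-1} A$, with $\psi_{n-1}$ applied first.\<close>

definition invertible_cell :: "'a cubical_data \<Rightarrow> nat \<Rightarrow> 'a \<Rightarrow> bool" where
  "invertible_cell C n A \<longleftrightarrow> R1_invertible C n (foldr (psi C n) [1..<n] A)"

definition T_equation :: "'a cubical_data \<Rightarrow> nat \<Rightarrow> nat \<Rightarrow> 'a \<Rightarrow> 'a \<Rightarrow> bool" where
  "T_equation C n i A B \<longleftrightarrow>
     cmp C n (i + 1)
       (cmp C n i (conn C (n - 1) i Plus (face C n (i + 1) Minus A)) B)
       (cmp C n i A (conn C (n - 1) i Minus (face C n i Plus A)))
     = cmp C n i (conn C (n - 1) i Minus (face C n i Minus A))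
                 (conn C (n - 1) i Plus (face C n (i + 1) Plus A))"

text \<open>
  The face conditions below make all the composites in \<open>T_equation C n i A B\<close> and
  \<open>T_equation C n i B A\<close> defined.
\<close>

definition is_T_inverse :: "'a cubical_data \<Rightarrow> nat \<Rightarrow> nat \<Rightarrow> 'a \<Rightarrow> 'a \<Rightarrow> bool" where
  "is_T_inverse C n i A B \<longleftrightarrow>
     A \<in> cells C n \<and> B \<in> cells C n \<and>
     (\<forall>\<alpha>. face C n i \<alpha> A = face C n (i + 1) \<alpha> B \<and> face C n (i + 1) \<alpha> A = face C n i \<alpha> B) \<and>
     T_equation C n i A B \<and> T_equation C n i B A"

definition T_invertible :: "'a cubical_data \<Rightarrow> nat \<Rightarrow> nat \<Rightarrow> 'a \<Rightarrow> bool" where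
  "T_invertible C n i A \<longleftrightarrow> (\<exists>B. is_T_inverse C n i A B)"

text \<open>
  Families $(A_i^\alpha)$ are extensional functions on pairs \<open>(i, \<alpha>)\<close>, so that two families are
  equal exactly when their members are.
\<close>

type_synonym 'a family = "nat \<times> sign \<Rightarrow> 'a"

abbreviation face_index :: "nat \<Rightarrow> (nat \<times> sign) set" where
  "face_index n \<equiv> {1..n} \<times> UNIV"

definition shells :: "nat \<Rightarrow> 'a cubical_data \<Rightarrow> 'a family set" where
  "shells n C =
     {F \<in> face_index (n + 1) \<rightarrow>\<^sub>E cells C n.
        \<forall>i \<in> {1..n + 1}. \<forall>j \<in> {1..n + 1}. \<forall>\<alpha> \<beta>. i \<noteq> j \<longrightarrow>
          face C n (down j i) \<alpha> (F (j, \<beta>)) = face C n (down i j) \<beta> (F (i, \<alpha>))}"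

definition degen_shell :: "nat \<Rightarrow> 'a cubical_data \<Rightarrow> nat \<Rightarrow> 'a \<Rightarrow> 'a family" where
  "degen_shell n C j A =
     (\<lambda>(i, \<alpha>) \<in> face_index (n + 1).
        if i = j then A
        else degen C (n - 1) (down i j) (face C n (down j i) \<alpha> A))"

definition conn_shell :: "nat \<Rightarrow> 'a cubical_data \<Rightarrow> nat \<Rightarrow> sign \<Rightarrow> 'a \<Rightarrow> 'a family" where
  "conn_shell n C j \<beta> A =
     (\<lambda>(i, \<alpha>) \<in> face_index (n + 1).
        if i = j \<or> i = j + 1
        then (if \<alpha> = \<beta> then A else degen C (n - 1) j (face C n j \<alpha> A))
        else conn C (n - 1) (down i j) \<beta> (face C n (down j i) \<alpha> A))"

definition cmp_shell :: "nat \<Rightarrow> 'a cubical_data \<Rightarrow> nat \<Rightarrow> 'a family \<Rightarrow> 'a family \<Rightarrow> 'a family" where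
  "cmp_shell n C i F G =
     (\<lambda>(j, \<alpha>) \<in> face_index (n + 1).
        if j = i then (if \<alpha> = Minus then F (j, \<alpha>) else G (j, \<alpha>))
        else cmp C n (down j i) (F (j, \<alpha>)) (G (j, \<alpha>)))"

datatype 'a box_cell = Inner 'a | Shell "'a family"

fun box_face :: "'a cubical_data \<Rightarrow> nat \<Rightarrow> nat \<Rightarrow> sign \<Rightarrow> 'a box_cell \<Rightarrow> 'a box_cell" where
  "box_face C m i \<alpha> (Inner A) = Inner (face C m i \<alpha> A)"
| "box_face C m i \<alpha> (Shell F) = Inner (F (i, \<alpha>))"

fun box_degen :: "nat \<Rightarrow> 'a cubical_data \<Rightarrow> nat \<Rightarrow> nat \<Rightarrow> 'a box_cell \<Rightarrow> 'a box_cell" where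
  "box_degen n C m i (Inner A) =
     (if m < n then Inner (degen C m i A) else Shell (degen_shell n C i A))"
| "box_degen n C m i (Shell F) = undefined"

fun box_conn :: "nat \<Rightarrow> 'a cubical_data \<Rightarrow> nat \<Rightarrow> nat \<Rightarrow> sign \<Rightarrow> 'a box_cell \<Rightarrow> 'a box_cell" where
  "box_conn n C m i \<alpha> (Inner A) =
     (if m < n then Inner (conn C m i \<alpha> A) else Shell (conn_shell n C i \<alpha> A))"
| "box_conn n C m i \<alpha> (Shell F) = undefined"

fun box_cmp :: "nat \<Rightarrow> 'a cubical_data \<Rightarrow> nat \<Rightarrow> nat \<Rightarrow> 'a box_cell \<Rightarrow> 'a box_cell \<Rightarrow> 'a box_cell" where
  "box_cmp n C m i (Inner A) (Inner B) = Inner (cmp C m i A B)"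
| "box_cmp n C m i (Shell F) (Shell G) = Shell (cmp_shell n C i F G)"
| "box_cmp n C m i _ _ = undefined"

text \<open>For a cubical \<open>n\<close>-category \<open>C\<close>, \<open>shell_category n C\<close> is the cubical \<open>(n + 1)\<close>-category $\Box C$.\<close>

definition shell_category :: "nat \<Rightarrow> 'a cubical_data \<Rightarrow> 'a box_cell cubical_data" where
  "shell_category n C =
     \<lparr>cells = (\<lambda>m. if m \<le> n then Inner ` cells C m
                   else if m = n + 1 then Shell ` shells n C else {}),
      face = box_face C,
      degen = box_degen n C,
      conn = box_conn n C,
      cmp = box_cmp n C\<rparr>"

definition shell_of :: "'a cubical_data \<Rightarrow> nat \<Rightarrow> 'a \<Rightarrow> 'a box_cell" where
  "shell_of C n A = Shell (\<lambda>(i, \<alpha>) \<in> face_index n. face C n i \<alpha> A)"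

definition has_T_invertible_shell :: "'a cubical_data \<Rightarrow> nat \<Rightarrow> nat \<Rightarrow> 'a \<Rightarrow> bool" where
  "has_T_invertible_shell C n i A \<longleftrightarrow>
     T_invertible (shell_category (n - 1) (truncation (n - 1) C)) n i (shell_of C n A)"

end

theory Submission
  imports Defs
begin

text \<open>
  Fix directions \<open>i\<close> and \<open>i + 1\<close>: the cells then form a double category with connections, in which
  a square is determined by its four sides and by its image under $\psi_i$, and every globular
  square with suitable boundary arises in this way.  Since $\psi_i$ sends the two sides of the
  equation of \<open>T\<close>-inverses to $\psi_i A \star_i \psi_i B$ and to a degenerate cell, \<open>A\<close> is
  $T_i$-invertible exactly when $\psi_i A$ is invertible for $\star_i$.

  It remains to compare this with the invertibility of $\psi_1\cdots\psi_{n-1}A$ for $\star_1$, one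
  $\psi_k$ at a time.  For $k > i$, $\psi_k$ preserves and reflects $T_i$-invertibility, because \<open>A\<close> is
  a composite of $\psi_k A$ with connections and degeneracies of its faces, which are
  $T_i$-invertible; then $\psi_i$ turns $T_i$-invertibility into invertibility for $\star_i$; and for
  $k < i$, $\psi_k$ turns invertibility for $\star_{k+1}$ into invertibility for $\star_k$.  The
  hypothesis on the shell provides the conditions on the faces needed at each step.
\<close>

subsection \<open>Double categories with connections\<close>

text \<open>An n-cell is viewed as a square: north and south are its faces in direction i, west and
  east those in direction i + 1, and \<open>vc\<close>, \<open>hc\<close> are the compositions in
  directions i and i + 1. Folding turns transposition into inversion: psi_i A runs from
  \<open>north A \<odot> east A\<close> to \<open>west A \<odot> south A\<close>, and transposing A
  exchanges these two edges.

  Applying psi_k preserves the property in question; undoing it costs conditions on faces. For k > i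
  the cell is rebuilt from psi_k A with thin cells on its faces, which must themselves be
  T_i-invertible. For k < i an inverse in direction k + 1 must have inverse north and south sides,
  so the faces in direction k must be invertible. \<open>T_faces\<close> and \<open>R_faces\<close>
  are face conditions that survive each folding.

  Instead A is cut into psi_i A and thin cells of the forms eps_i and Gamma_i, and Gamma_{i+1} is
  treated on each piece.\<close>

locale partial_category =
  fixes Ob :: "'o set" and Ar :: "'e set" and src tgt :: "'e \<Rightarrow> 'o" and one :: "'o \<Rightarrow> 'e"
    and comp :: "'e \<Rightarrow> 'e \<Rightarrow> 'e"
  assumes src_closed [simp]: "f \<in> Ar \<Longrightarrow> src f \<in> Ob"
    and tgt_closed [simp]: "f \<in> Ar \<Longrightarrow> tgt f \<in> Ob"
    and one_closed [simp]: "x \<in> Ob \<Longrightarrow> one x \<in> Ar"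
    and comp_closed [simp]: "\<lbrakk>f \<in> Ar; g \<in> Ar; tgt f = src g\<rbrakk> \<Longrightarrow> comp f g \<in> Ar"
    and src_one [simp]: "x \<in> Ob \<Longrightarrow> src (one x) = x"
    and tgt_one [simp]: "x \<in> Ob \<Longrightarrow> tgt (one x) = x"
    and src_comp [simp]: "\<lbrakk>f \<in> Ar; g \<in> Ar; tgt f = src g\<rbrakk> \<Longrightarrow> src (comp f g) = src f"
    and tgt_comp [simp]: "\<lbrakk>f \<in> Ar; g \<in> Ar; tgt f = src g\<rbrakk> \<Longrightarrow> tgt (comp f g) = tgt g"
    and assoc: "\<lbrakk>f \<in> Ar; g \<in> Ar; k \<in> Ar; tgt f = src g; tgt g = src k\<rbrakk>
      \<Longrightarrow> comp (comp f g) k = comp f (comp g k)"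
    and unit_right [simp]: "\<lbrakk>f \<in> Ar; tgt f = x\<rbrakk> \<Longrightarrow> comp f (one x) = f"
    and unit_left [simp]: "\<lbrakk>f \<in> Ar; src f = x\<rbrakk> \<Longrightarrow> comp (one x) f = f"
begin

definition inverse_arrows :: "'e \<Rightarrow> 'e \<Rightarrow> bool" where
  "inverse_arrows f g \<longleftrightarrow> f \<in> Ar \<and> g \<in> Ar \<and> tgt f = src g \<and> tgt g = src f \<and>
     comp f g = one (src f) \<and> comp g f = one (tgt f)"

definition invertible :: "'e \<Rightarrow> bool" where
  "invertible f \<longleftrightarrow> (\<exists>g. inverse_arrows f g)"

lemma inverse_arrowsD:
  assumes "inverse_arrows f g"
  shows "f \<in> Ar" "g \<in> Ar" "tgt f = src g" "tgt g = src f"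
    "comp f g = one (src f)" "comp g f = one (tgt f)"
  using assms by (auto simp: inverse_arrows_def)

lemma inverse_arrows_unique:
  assumes "inverse_arrows f g" "inverse_arrows f k"
  shows "g = k"
proof -
  note g = inverse_arrowsD[OF assms(1)] and k = inverse_arrowsD[OF assms(2)]
  have "comp (comp g f) k = comp g (comp f k)"
    using g k by (intro assoc) auto
  then show ?thesis using g k by simp
qed

lemma inverse_arrows_one: "x \<in> Ob \<Longrightarrow> inverse_arrows (one x) (one x)"
  by (simp add: inverse_arrows_def)

lemma inverse_arrows_comp:
  assumes "inverse_arrows f f'" "inverse_arrows g g'" "tgt f = src g"
  shows "inverse_arrows (comp f g) (comp g' f')"
proof -
  note f = inverse_arrowsD[OF assms(1)] and g = inverse_arrowsD[OF assms(2)]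
  have "comp (comp f g) (comp g' f') = comp f (comp (comp g g') f')"
    using f(1-4) g(1-4) assms(3) by (simp add: assoc)
  also have "\<dots> = one (src f)" using f g assms(3) by simp
  finally have 1: "comp (comp f g) (comp g' f') = one (src f)" .
  have "comp (comp g' f') (comp f g) = comp g' (comp (comp f' f) g)"
    using f(1-4) g(1-4) assms(3) by (simp add: assoc)
  also have "\<dots> = one (tgt g)" using f g assms(3) by simp
  finally have 2: "comp (comp g' f') (comp f g) = one (tgt g)" .
  show ?thesis using 1 2 f(1-4) g(1-4) assms(3) by (simp add: inverse_arrows_def)
qed

lemma invertible_one: "x \<in> Ob \<Longrightarrow> invertible (one x)"
  using inverse_arrows_one invertible_def by blast

lemma invertible_comp: "\<lbrakk>invertible f; invertible g; tgt f = src g\<rbrakk> \<Longrightarrow> invertible (comp f g)"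
  using inverse_arrows_comp invertible_def by blast

lemma invertible_closed: "invertible f \<Longrightarrow> f \<in> Ar"
  using inverse_arrowsD(1) invertible_def by blast

end

text \<open>Both kinds of sides are arrows of one category \<open>E\<close>, because all faces of an
  n-cell are (n-1)-cells; hence sides of different directions can be composed, as in
  \<open>north A \<odot> east A\<close>. \<open>e1 f\<close> is a unit for \<open>vc\<close> and
  \<open>e2 f\<close> for \<open>hc\<close>; \<open>gm_ec\<close> and \<open>gp_ec\<close> are the
  transport laws of the connections.\<close>

locale double_category =
  edge: partial_category Ob E src tgt one ec +
  vert: partial_category E S north south e1 vc +
  horiz: partial_category E S west east e2 hc
  for Ob :: "'o set" and E :: "'e set" and src tgt :: "'e \<Rightarrow> 'o" and one :: "'o \<Rightarrow> 'e"
    and ec :: "'e \<Rightarrow> 'e \<Rightarrow> 'e" (infixl "\<odot>" 70)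
    and S :: "'s set" and north south west east :: "'s \<Rightarrow> 'e" and e1 e2 :: "'e \<Rightarrow> 's"
    and vc :: "'s \<Rightarrow> 's \<Rightarrow> 's" (infixl "\<odot>\<^sub>v" 70)
    and hc :: "'s \<Rightarrow> 's \<Rightarrow> 's" (infixl "\<odot>\<^sub>h" 70) +
  fixes gp gm :: "'e \<Rightarrow> 's"
  assumes src_west [simp]: "A \<in> S \<Longrightarrow> src (west A) = src (north A)"
    and src_east [simp]: "A \<in> S \<Longrightarrow> src (east A) = tgt (north A)"
    and src_south [simp]: "A \<in> S \<Longrightarrow> src (south A) = tgt (west A)"
    and tgt_east [simp]: "A \<in> S \<Longrightarrow> tgt (east A) = tgt (south A)"
    and west_vc [simp]: "\<lbrakk>A \<in> S; B \<in> S; south A = north B\<rbrakk> \<Longrightarrow> west (A \<odot>\<^sub>v B) = west A \<odot> west B"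
    and east_vc [simp]: "\<lbrakk>A \<in> S; B \<in> S; south A = north B\<rbrakk> \<Longrightarrow> east (A \<odot>\<^sub>v B) = east A \<odot> east B"
    and north_hc [simp]: "\<lbrakk>A \<in> S; B \<in> S; east A = west B\<rbrakk> \<Longrightarrow> north (A \<odot>\<^sub>h B) = north A \<odot> north B"
    and south_hc [simp]: "\<lbrakk>A \<in> S; B \<in> S; east A = west B\<rbrakk> \<Longrightarrow> south (A \<odot>\<^sub>h B) = south A \<odot> south B"
    and west_e1 [simp]: "f \<in> E \<Longrightarrow> west (e1 f) = one (src f)"
    and east_e1 [simp]: "f \<in> E \<Longrightarrow> east (e1 f) = one (tgt f)"
    and north_e2 [simp]: "f \<in> E \<Longrightarrow> north (e2 f) = one (src f)"
    and south_e2 [simp]: "f \<in> E \<Longrightarrow> south (e2 f) = one (tgt f)"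
    and e1_ec: "\<lbrakk>f \<in> E; g \<in> E; tgt f = src g\<rbrakk> \<Longrightarrow> e1 (f \<odot> g) = e1 f \<odot>\<^sub>h e1 g"
    and e2_ec: "\<lbrakk>f \<in> E; g \<in> E; tgt f = src g\<rbrakk> \<Longrightarrow> e2 (f \<odot> g) = e2 f \<odot>\<^sub>v e2 g"
    and e2_one [simp]: "x \<in> Ob \<Longrightarrow> e2 (one x) = e1 (one x)"
    and interchange: "\<lbrakk>A \<in> S; B \<in> S; D \<in> S; F \<in> S; south A = north D; south B = north F;
      east A = west B; east D = west F\<rbrakk>
      \<Longrightarrow> (A \<odot>\<^sub>h B) \<odot>\<^sub>v (D \<odot>\<^sub>h F) = (A \<odot>\<^sub>v D) \<odot>\<^sub>h (B \<odot>\<^sub>v F)"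
    and gp_closed [simp]: "f \<in> E \<Longrightarrow> gp f \<in> S"
    and gm_closed [simp]: "f \<in> E \<Longrightarrow> gm f \<in> S"
    and north_gp [simp]: "f \<in> E \<Longrightarrow> north (gp f) = one (src f)"
    and west_gp [simp]: "f \<in> E \<Longrightarrow> west (gp f) = one (src f)"
    and south_gp [simp]: "f \<in> E \<Longrightarrow> south (gp f) = f"
    and east_gp [simp]: "f \<in> E \<Longrightarrow> east (gp f) = f"
    and north_gm [simp]: "f \<in> E \<Longrightarrow> north (gm f) = f"
    and west_gm [simp]: "f \<in> E \<Longrightarrow> west (gm f) = f"
    and south_gm [simp]: "f \<in> E \<Longrightarrow> south (gm f) = one (tgt f)"
    and east_gm [simp]: "f \<in> E \<Longrightarrow> east (gm f) = one (tgt f)"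
    and gm_ec: "\<lbrakk>f \<in> E; g \<in> E; tgt f = src g\<rbrakk>
      \<Longrightarrow> gm (f \<odot> g) = (gm f \<odot>\<^sub>v e2 g) \<odot>\<^sub>h (e1 g \<odot>\<^sub>v gm g)"
    and gp_ec: "\<lbrakk>f \<in> E; g \<in> E; tgt f = src g\<rbrakk>
      \<Longrightarrow> gp (f \<odot> g) = (gp f \<odot>\<^sub>v e1 f) \<odot>\<^sub>h (e2 f \<odot>\<^sub>v gp g)"
    and gp_vc_gm [simp]: "f \<in> E \<Longrightarrow> gp f \<odot>\<^sub>v gm f = e2 f"
    and gp_hc_gm [simp]: "f \<in> E \<Longrightarrow> gp f \<odot>\<^sub>h gm f = e1 f"
    and gp_one [simp]: "x \<in> Ob \<Longrightarrow> gp (one x) = e1 (one x)"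
    and gm_one [simp]: "x \<in> Ob \<Longrightarrow> gm (one x) = e1 (one x)"
begin

definition folding :: "'s \<Rightarrow> 's" where
  "folding A = gp (west A) \<odot>\<^sub>h A \<odot>\<^sub>h gm (east A)"

text \<open>Since \<open>e2_one\<close> rewrites \<open>e2 (one x)\<close> to
  \<open>e1 (one x)\<close>, the unit laws of \<open>horiz\<close> no longer match on identities;
  this restores them for the simplified form.\<close>

lemma unit_hc_left [simp]: "\<lbrakk>A \<in> S; x \<in> Ob; west A = one x\<rbrakk> \<Longrightarrow> e1 (one x) \<odot>\<^sub>h A = A"
  using horiz.unit_left[of A "one x"] by simp

lemma unit_hc_right [simp]: "\<lbrakk>A \<in> S; x \<in> Ob; east A = one x\<rbrakk> \<Longrightarrow> A \<odot>\<^sub>h e1 (one x) = A"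
  using horiz.unit_right[of A "one x"] by simp

lemma folding_closed [simp]: "A \<in> S \<Longrightarrow> folding A \<in> S"
  by (simp add: folding_def)

lemma north_folding [simp]: "A \<in> S \<Longrightarrow> north (folding A) = north A \<odot> east A"
  by (simp add: folding_def)

lemma south_folding [simp]: "A \<in> S \<Longrightarrow> south (folding A) = west A \<odot> south A"
  by (simp add: folding_def)

lemma west_folding [simp]: "A \<in> S \<Longrightarrow> west (folding A) = one (src (north A))"
  by (simp add: folding_def)

lemma east_folding [simp]: "A \<in> S \<Longrightarrow> east (folding A) = one (tgt (south A))"
  by (simp add: folding_def)

text \<open>The 2 by 2 array of \<open>gp_ec\<close> read by rows: interchange makes the upper row
  \<open>gp f\<close> followed by the horizontal unit \<open>e2 f\<close>, which disappears.\<close>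

lemma gp_ec_rows: "\<lbrakk>f \<in> E; g \<in> E; tgt f = src g\<rbrakk> \<Longrightarrow> gp (f \<odot> g) = gp f \<odot>\<^sub>v (e1 f \<odot>\<^sub>h gp g)"
  using interchange[of "gp f" "e2 f" "e1 f" "gp g"] by (simp add: gp_ec)

lemma gm_ec_rows: "\<lbrakk>f \<in> E; g \<in> E; tgt f = src g\<rbrakk> \<Longrightarrow> gm (f \<odot> g) = (gm f \<odot>\<^sub>h e1 g) \<odot>\<^sub>v gm g"
  using interchange[of "gm f" "e1 g" "e2 g" "gm g"] by (simp add: gm_ec)

text \<open>The connections on the composite west and east sides split into two rows by
  \<open>gp_ec_rows\<close> and \<open>gm_ec_rows\<close>; interchange then separates the upper row,
  which contains \<open>A\<close>, from the lower row, which contains \<open>B\<close>.\<close>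

lemma folding_vc:
  assumes "A \<in> S" "B \<in> S" "south A = north B"
  shows "folding (A \<odot>\<^sub>v B) = (folding A \<odot>\<^sub>h e1 (east B)) \<odot>\<^sub>v (e1 (west A) \<odot>\<^sub>h folding B)"
proof -
  note [simp] = assms(1,2)
  have c[simp]: "src (north B) = tgt (west A)"
    using src_south[of A] assms by simp
  have top: "folding A \<odot>\<^sub>h e1 (east B) = (gp (west A) \<odot>\<^sub>h A) \<odot>\<^sub>h (gm (east A) \<odot>\<^sub>h e1 (east B))"
    unfolding folding_def using assms(3) by (subst horiz.assoc) simp_all
  have bot: "e1 (west A) \<odot>\<^sub>h folding B = ((e1 (west A) \<odot>\<^sub>h gp (west B)) \<odot>\<^sub>h B) \<odot>\<^sub>h gm (east B)"
    unfolding folding_def using assms(3) by (simp add: horiz.assoc)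
  have "(folding A \<odot>\<^sub>h e1 (east B)) \<odot>\<^sub>v (e1 (west A) \<odot>\<^sub>h folding B)
    = ((gp (west A) \<odot>\<^sub>h A) \<odot>\<^sub>v ((e1 (west A) \<odot>\<^sub>h gp (west B)) \<odot>\<^sub>h B))
      \<odot>\<^sub>h ((gm (east A) \<odot>\<^sub>h e1 (east B)) \<odot>\<^sub>v gm (east B))"
    unfolding top bot using assms(3) by (subst interchange) simp_all
  also have "(gp (west A) \<odot>\<^sub>h A) \<odot>\<^sub>v ((e1 (west A) \<odot>\<^sub>h gp (west B)) \<odot>\<^sub>h B)
    = (gp (west A) \<odot>\<^sub>v (e1 (west A) \<odot>\<^sub>h gp (west B))) \<odot>\<^sub>h (A \<odot>\<^sub>v B)"
    using assms(3) by (subst interchange) simp_all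
  finally show ?thesis using assms(3) by (simp add: folding_def gp_ec_rows gm_ec_rows)
qed

text \<open>The common side of \<open>A\<close> and \<open>B\<close> is replaced by a column
  \<open>gp (west B)\<close> over \<open>gm (west B)\<close>, which is a horizontal unit. This
  supplies the east connection of \<open>A\<close> and the west connection of \<open>B\<close>, and
  leaves a staircase with \<open>B\<close> folded in the upper row and \<open>A\<close> in the lower
  one.\<close>

lemma folding_hc:
  assumes "A \<in> S" "B \<in> S" "east A = west B"
  shows "folding (A \<odot>\<^sub>h B) = (e1 (north A) \<odot>\<^sub>h folding B) \<odot>\<^sub>v (folding A \<odot>\<^sub>h e1 (south B))"
proof -
  note [simp] = assms(1,2)
  have c[simp]: "src (north B) = tgt (north A)" and d[simp]: "tgt (west B) = tgt (south A)"
    using src_west[of B] tgt_east[of A] assms src_east[of A] by auto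
  \<comment> \<open>Both rows are padded with an identity square, at the left of the upper and at
    the right of the lower one, so that each has five squares. These units must not be simplified
    away before interchange has been applied column by column.\<close>
  have top: "e1 (north A) \<odot>\<^sub>h folding B
     = e1 (one (src (north A))) \<odot>\<^sub>h (e1 (north A) \<odot>\<^sub>h gp (west B) \<odot>\<^sub>h B \<odot>\<^sub>h gm (east B))"
    unfolding folding_def using assms(3) by (simp add: horiz.assoc)
  have bot: "folding A \<odot>\<^sub>h e1 (south B) =
     gp (west A) \<odot>\<^sub>h (A \<odot>\<^sub>h gm (west B) \<odot>\<^sub>h e1 (south B) \<odot>\<^sub>h e1 (one (tgt (south B))))"
    unfolding folding_def using assms(3) by (simp add: horiz.assoc)
  have "(e1 (north A) \<odot>\<^sub>h folding B) \<odot>\<^sub>v (folding A \<odot>\<^sub>h e1 (south B)) =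
     (e1 (one (src (north A))) \<odot>\<^sub>v gp (west A)) \<odot>\<^sub>h
     ((e1 (north A) \<odot>\<^sub>h gp (west B) \<odot>\<^sub>h B \<odot>\<^sub>h gm (east B)) \<odot>\<^sub>v
      (A \<odot>\<^sub>h gm (west B) \<odot>\<^sub>h e1 (south B) \<odot>\<^sub>h e1 (one (tgt (south B)))))"
    unfolding top bot using assms(3)
    by (subst interchange) (simp_all del: unit_hc_left unit_hc_right)
  also have "(e1 (north A) \<odot>\<^sub>h gp (west B) \<odot>\<^sub>h B \<odot>\<^sub>h gm (east B)) \<odot>\<^sub>v
      (A \<odot>\<^sub>h gm (west B) \<odot>\<^sub>h e1 (south B) \<odot>\<^sub>h e1 (one (tgt (south B))))
     = ((e1 (north A) \<odot>\<^sub>h gp (west B) \<odot>\<^sub>h B) \<odot>\<^sub>v (A \<odot>\<^sub>h gm (west B) \<odot>\<^sub>h e1 (south B)))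
       \<odot>\<^sub>h (gm (east B) \<odot>\<^sub>v e1 (one (tgt (south B))))"
    using assms(3) by (subst interchange) (simp_all del: unit_hc_left unit_hc_right)
  also have "(e1 (north A) \<odot>\<^sub>h gp (west B) \<odot>\<^sub>h B) \<odot>\<^sub>v (A \<odot>\<^sub>h gm (west B) \<odot>\<^sub>h e1 (south B))
     = ((e1 (north A) \<odot>\<^sub>h gp (west B)) \<odot>\<^sub>v (A \<odot>\<^sub>h gm (west B))) \<odot>\<^sub>h (B \<odot>\<^sub>v e1 (south B))"
    using assms(3) by (subst interchange) simp_all
  also have "(e1 (north A) \<odot>\<^sub>h gp (west B)) \<odot>\<^sub>v (A \<odot>\<^sub>h gm (west B))
     = (e1 (north A) \<odot>\<^sub>v A) \<odot>\<^sub>h (gp (west B) \<odot>\<^sub>v gm (west B))"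
    using assms(3) by (subst interchange) simp_all
  finally show ?thesis using assms(3) by (simp add: folding_def horiz.assoc)
qed

lemma folding_e1 [simp]: "f \<in> E \<Longrightarrow> folding (e1 f) = e1 f"
  by (simp add: folding_def)

lemma folding_e2 [simp]: "f \<in> E \<Longrightarrow> folding (e2 f) = e1 f"
  by (simp add: folding_def)

lemma folding_gp [simp]: "f \<in> E \<Longrightarrow> folding (gp f) = e1 f"
  by (simp add: folding_def)

lemma folding_gm [simp]: "f \<in> E \<Longrightarrow> folding (gm f) = e1 f"
  by (simp add: folding_def)

lemma folding_globular: "\<lbrakk>A \<in> S; x \<in> Ob; y \<in> Ob; west A = one x; east A = one y\<rbrakk> \<Longrightarrow> folding A = A"
  by (simp add: folding_def)

section \<open>Recovering a square from its sides and its folding\<close>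

definition unfold :: "'e \<Rightarrow> 'e \<Rightarrow> 'e \<Rightarrow> 'e \<Rightarrow> 's \<Rightarrow> 's" where
  "unfold u c d v Z = (e1 u \<odot>\<^sub>h gp d) \<odot>\<^sub>v Z \<odot>\<^sub>v (gm c \<odot>\<^sub>h e1 v)"

text \<open>The two added rows cancel the connections of the folding: \<open>gp (east A)\<close>
  comes to lie over \<open>gm (east A)\<close> and \<open>gp (west A)\<close> over
  \<open>gm (west A)\<close>, and by \<open>gp_vc_gm\<close> each of these columns is a horizontal
  unit.\<close>

lemma unfold_folding:
  assumes [simp]: "A \<in> S"
  shows "unfold (north A) (west A) (east A) (south A) (folding A) = A"
proof -
  have row1: "e1 (north A) \<odot>\<^sub>h gp (east A) = (e1 (one (src (north A))) \<odot>\<^sub>h e1 (north A)) \<odot>\<^sub>h gp (east A)"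
    by simp
  have row3: "gm (west A) \<odot>\<^sub>h e1 (south A) = (gm (west A) \<odot>\<^sub>h e1 (south A)) \<odot>\<^sub>h e1 (one (tgt (south A)))"
    by simp
  have "(e1 (north A) \<odot>\<^sub>h gp (east A)) \<odot>\<^sub>v folding A
     = ((e1 (one (src (north A))) \<odot>\<^sub>h e1 (north A)) \<odot>\<^sub>v (gp (west A) \<odot>\<^sub>h A)) \<odot>\<^sub>h (gp (east A) \<odot>\<^sub>v gm (east A))"
    unfolding row1 folding_def
    by (subst interchange) (simp_all)
  also have "(e1 (one (src (north A))) \<odot>\<^sub>h e1 (north A)) \<odot>\<^sub>v (gp (west A) \<odot>\<^sub>h A)
    = (e1 (one (src (north A))) \<odot>\<^sub>v gp (west A)) \<odot>\<^sub>h (e1 (north A) \<odot>\<^sub>v A)"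
    by (subst interchange) (simp_all del: unit_hc_left unit_hc_right)
  finally have 1: "(e1 (north A) \<odot>\<^sub>h gp (east A)) \<odot>\<^sub>v folding A = gp (west A) \<odot>\<^sub>h A"
    by simp
  have "(gp (west A) \<odot>\<^sub>h A) \<odot>\<^sub>v (gm (west A) \<odot>\<^sub>h e1 (south A))
    = (gp (west A) \<odot>\<^sub>v gm (west A)) \<odot>\<^sub>h (A \<odot>\<^sub>v e1 (south A))"
    by (subst interchange) simp_all
  then show ?thesis unfolding unfold_def 1 by simp
qed

lemma folding_inject:
  assumes "A \<in> S" "B \<in> S" "north A = north B" "west A = west B" "east A = east B"
    "south A = south B" "folding A = folding B"
  shows "A = B"
  using unfold_folding assms by metis

text \<open>Both outer rows of \<open>unfold\<close> fold to vertical units, and \<open>Z\<close>,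
  having identities as west and east sides, is its own folding. This is the source of inverses
  below: a square is produced by giving its sides and its folding.\<close>

lemma unfold_props:
  assumes [simp]: "u \<in> E" "c \<in> E" "d \<in> E" "v \<in> E" "Z \<in> S"
    and [simp]: "src c = src u" "src d = tgt u" "src v = tgt c" "tgt d = tgt v"
    and [simp]: "north Z = u \<odot> d" "south Z = c \<odot> v" "west Z = one (src u)" "east Z = one (tgt v)"
  shows "unfold u c d v Z \<in> S" "north (unfold u c d v Z) = u" "west (unfold u c d v Z) = c"
    "east (unfold u c d v Z) = d" "south (unfold u c d v Z) = v" "folding (unfold u c d v Z) = Z"
proof -
  have pz [simp]: "folding Z = Z"
    by (rule folding_globular[of _ "src u" "tgt v"]) auto
  have p: "folding (e1 u \<odot>\<^sub>h gp d) = e1 (u \<odot> d)" "folding (gm c \<odot>\<^sub>h e1 v) = e1 (c \<odot> v)"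
    by (simp_all add: folding_hc flip: e1_ec)
  show "unfold u c d v Z \<in> S" "north (unfold u c d v Z) = u" "west (unfold u c d v Z) = c"
    "east (unfold u c d v Z) = d" "south (unfold u c d v Z) = v"
    by (simp_all add: unfold_def)
  show "folding (unfold u c d v Z) = Z"
    by (simp add: unfold_def folding_vc p)
qed

section \<open>Vertically and horizontally invertible squares\<close>

lemma e1_invertible: "f \<in> E \<Longrightarrow> vert.invertible (e1 f)"
  by (rule vert.invertible_one)

lemma inverse_faces_v:
  assumes "vert.inverse_arrows A B"
  shows "edge.inverse_arrows (west A) (west B)" "edge.inverse_arrows (east A) (east B)"
proof -
  note A = vert.inverse_arrowsD[OF assms]
  have 1: "src (north B) = tgt (west A)" "src (north A) = tgt (west B)"
     using src_south[of A] src_south[of B] A by auto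
  have "west (A \<odot>\<^sub>v B) = one (src (north A))" "west (B \<odot>\<^sub>v A) = one (src (north B))"
    "east (A \<odot>\<^sub>v B) = one (tgt (north A))" "east (B \<odot>\<^sub>v A) = one (tgt (north B))"
    unfolding A(5,6) using A(1-4) by simp_all
  then show "edge.inverse_arrows (west A) (west B)" "edge.inverse_arrows (east A) (east B)"
    using A(1-4) 1 by (auto simp: edge.inverse_arrows_def)
qed

lemma inverse_faces_h:
  assumes "horiz.inverse_arrows A B"
  shows "edge.inverse_arrows (north A) (north B)" "edge.inverse_arrows (south A) (south B)"
proof -
  note A = horiz.inverse_arrowsD[OF assms]
  have 1: "src (north B) = tgt (north A)" "src (north A) = tgt (north B)"
     using src_west[of A] src_west[of B] A src_east[of A] src_east[of B] by auto
  have 2: "tgt (west B) = tgt (south A)" "tgt (west A) = tgt (south B)"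
     using A tgt_east[of A] tgt_east[of B] by auto
  have "north (A \<odot>\<^sub>h B) = one (src (west A))" "north (B \<odot>\<^sub>h A) = one (src (west B))"
    "south (A \<odot>\<^sub>h B) = one (tgt (west A))" "south (B \<odot>\<^sub>h A) = one (tgt (west B))"
    unfolding A(5,6) using A(1-4) by simp_all
  then show "edge.inverse_arrows (north A) (north B)" "edge.inverse_arrows (south A) (south B)"
    using A(1-4) 1 2 by (auto simp: edge.inverse_arrows_def)
qed

lemma invertible_hc:
  assumes "vert.invertible A" "vert.invertible B" and [simp]: "east A = west B"
  shows "vert.invertible (A \<odot>\<^sub>h B)"
proof -
  obtain A' B' where A': "vert.inverse_arrows A A'" and B': "vert.inverse_arrows B B'"
    using assms by (auto simp: vert.invertible_def)
  note A = vert.inverse_arrowsD[OF A'] and B = vert.inverse_arrowsD[OF B']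
  note [simp] = A(1,2) B(1,2)
  \<comment> \<open>The two inverses fit together because both of these sides are inverse to the
    common edge \<open>west B\<close>, and edge inverses are unique.\<close>
  have [simp]: "east A' = west B'"
    using edge.inverse_arrows_unique[of "west B"] inverse_faces_v[OF A'] inverse_faces_v[OF B'] by simp
  have tt: "tgt (north A) = src (north B)" "tgt (north A') = src (north B')"
    using src_east[of A] src_east[of A'] by simp_all
  have "(A \<odot>\<^sub>h B) \<odot>\<^sub>v (A' \<odot>\<^sub>h B') = e1 (north A) \<odot>\<^sub>h e1 (north B)"
    using A B by (simp add: interchange)
  moreover have "(A' \<odot>\<^sub>h B') \<odot>\<^sub>v (A \<odot>\<^sub>h B) = e1 (south A) \<odot>\<^sub>h e1 (south B)"
    using A B by (simp add: interchange)
  ultimately have "vert.inverse_arrows (A \<odot>\<^sub>h B) (A' \<odot>\<^sub>h B')"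
    using A(1-4) B(1-4) tt by (simp add: vert.inverse_arrows_def e1_ec)
  then show ?thesis using vert.invertible_def by blast
qed

text \<open>If \<open>g\<close> is inverse to \<open>f\<close>, then \<open>gm (f \<odot> g)\<close>
  and \<open>gm (g \<odot> f)\<close> are degenerate, and \<open>gm_ec_rows\<close> splits them.
  Reading off the rows gives the vertical inverse \<open>gm g \<odot>\<^sub>h e1 f\<close>.\<close>

lemma invertible_gm:
  assumes "edge.invertible f"
  shows "vert.invertible (gm f)"
proof -
  obtain g where "edge.inverse_arrows f g" using assms by (auto simp: edge.invertible_def)
  note fg = edge.inverse_arrowsD[OF this]
  note [simp] = fg(1-4)
  have "(gm f) \<odot>\<^sub>v (gm g \<odot>\<^sub>h e1 f) = ((gm f \<odot>\<^sub>h e1 g) \<odot>\<^sub>h e1 f) \<odot>\<^sub>v (gm g \<odot>\<^sub>h e1 f)"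
    using fg by (simp add: horiz.assoc flip: e1_ec)
  also have "\<dots> = gm (f \<odot> g) \<odot>\<^sub>h e1 f"
    by (simp add: interchange gm_ec_rows)
  also have "\<dots> = e1 f" using fg by simp
  finally have 1: "(gm f) \<odot>\<^sub>v (gm g \<odot>\<^sub>h e1 f) = e1 f" .
  have "(gm g \<odot>\<^sub>h e1 f) \<odot>\<^sub>v gm f = gm (g \<odot> f)"
    by (simp add: gm_ec_rows)
  also have "\<dots> = e1 (one (tgt f))" using fg by simp
  finally have 2: "(gm g \<odot>\<^sub>h e1 f) \<odot>\<^sub>v gm f = e1 (one (tgt f))" .
  have "vert.inverse_arrows (gm f) (gm g \<odot>\<^sub>h e1 f)"
    using 1 2 fg by (simp add: vert.inverse_arrows_def)
  then show ?thesis using vert.invertible_def by blast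
qed

lemma invertible_gp:
  assumes "edge.invertible f"
  shows "vert.invertible (gp f)"
proof -
  obtain g where "edge.inverse_arrows f g" using assms by (auto simp: edge.invertible_def)
  note fg = edge.inverse_arrowsD[OF this]
  note [simp] = fg(1-4)
  have "(e1 f \<odot>\<^sub>h gp g) \<odot>\<^sub>v gp f = (e1 f \<odot>\<^sub>h gp g) \<odot>\<^sub>v (e1 f \<odot>\<^sub>h (e1 g \<odot>\<^sub>h gp f))"
    using fg by (simp flip: e1_ec horiz.assoc)
  also have "\<dots> = e1 f \<odot>\<^sub>h gp (g \<odot> f)"
    by (simp add: interchange gp_ec_rows)
  also have "\<dots> = e1 f" using fg by simp
  finally have 1: "(e1 f \<odot>\<^sub>h gp g) \<odot>\<^sub>v gp f = e1 f" .
  have "gp f \<odot>\<^sub>v (e1 f \<odot>\<^sub>h gp g) = gp (f \<odot> g)"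
    by (simp add: gp_ec_rows)
  also have "\<dots> = e1 (one (src f))" using fg by simp
  finally have 2: "gp f \<odot>\<^sub>v (e1 f \<odot>\<^sub>h gp g) = e1 (one (src f))" .
  have "vert.inverse_arrows (gp f) (e1 f \<odot>\<^sub>h gp g)"
    using 1 2 fg by (simp add: vert.inverse_arrows_def)
  then show ?thesis using vert.invertible_def by blast
qed

lemma invertible_folding:
  assumes "vert.invertible A"
  shows "vert.invertible (folding A)"
proof -
  have [simp]: "A \<in> S" using assms vert.invertible_closed by auto
  have "edge.invertible (west A)" "edge.invertible (east A)"
    using assms inverse_faces_v by (meson vert.invertible_def edge.invertible_def)+
  then show ?thesis
    unfolding folding_def using assms by (intro invertible_hc invertible_gp invertible_gm) simp_all
qed

lemma invertible_folding_vc: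
  assumes "A \<in> S" "B \<in> S" "south A = north B" "vert.invertible (folding A)" "vert.invertible (folding B)"
  shows "vert.invertible (folding (A \<odot>\<^sub>v B))"
proof -
  have t: "tgt (south A) = tgt (north B)" "src (north B) = tgt (west A)"
    using src_south[of A] assms by auto
  show ?thesis
    unfolding folding_vc[OF assms(1-3)] using assms t
    by (intro vert.invertible_comp invertible_hc e1_invertible) (simp_all add: edge.assoc)
qed

lemma invertible_folding_hc:
  assumes "A \<in> S" "B \<in> S" "east A = west B" "vert.invertible (folding A)" "vert.invertible (folding B)"
  shows "vert.invertible (folding (A \<odot>\<^sub>h B))"
proof -
  have t: "src (north B) = tgt (north A)" "tgt (west B) = tgt (south A)"
    using src_west[of B] tgt_east[of A] assms src_east[of A] by auto
  show ?thesis
    unfolding folding_hc[OF assms(1-3)] using assms t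
    by (intro vert.invertible_comp invertible_hc e1_invertible) (simp_all add: edge.assoc)
qed

text \<open>Applying \<open>folding_hc\<close> to the two composites of \<open>A\<close> with its
  inverse \<open>B\<close>, which fold to units, gives one-sided inverses of
  \<open>folding A\<close> whiskered by \<open>south B\<close> or by \<open>north B\<close>.
  Whiskering again by \<open>south A\<close> or \<open>north A\<close> removes these edges, as the
  sides of \<open>A\<close> and \<open>B\<close> are inverse to each other.\<close>

lemma invertible_folding_if_horiz:
  assumes "horiz.invertible A"
  shows "vert.invertible (folding A)"
proof -
  obtain B where B: "horiz.inverse_arrows A B" using assms by (auto simp: horiz.invertible_def)
  note AB = horiz.inverse_arrowsD[OF B]
  note n = edge.inverse_arrowsD[OF inverse_faces_h(1)[OF B]]
    and s = edge.inverse_arrowsD[OF inverse_faces_h(2)[OF B]]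
  note [simp] = AB(1-2) AB(3)[symmetric] AB(4)[symmetric] n(1-2) s(1-2) n(3,4)[symmetric]
  let ?X = "e1 (north A) \<odot>\<^sub>h folding B" and ?Y = "folding B \<odot>\<^sub>h e1 (south A)"
  have 1: "?X \<odot>\<^sub>v (folding A \<odot>\<^sub>h e1 (south B)) = e1 (west A)"
    using folding_hc[of A B] AB(5) by simp
  have 2: "(e1 (north B) \<odot>\<^sub>h folding A) \<odot>\<^sub>v ?Y = e1 (east A)"
    using folding_hc[of B A] AB(6) by simp
  have e: "e1 (south B) \<odot>\<^sub>h e1 (south A) = e1 (one (tgt (south A)))"
    "e1 (north A) \<odot>\<^sub>h e1 (north B) = e1 (one (src (north A)))"
    using n(5) s(6) e1_ec[of "south B" "south A"] e1_ec[of "north A" "north B"] by simp_all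
  have pA: "folding A = folding A \<odot>\<^sub>h e1 (south B) \<odot>\<^sub>h e1 (south A)"
    by (simp add: horiz.assoc e)
  have pA': "folding A = e1 (north A) \<odot>\<^sub>h (e1 (north B) \<odot>\<^sub>h folding A)"
    by (simp add: e flip: horiz.assoc)
  have "(?X \<odot>\<^sub>h e1 (south A)) \<odot>\<^sub>v (folding A \<odot>\<^sub>h e1 (south B) \<odot>\<^sub>h e1 (south A)) = (?X \<odot>\<^sub>v (folding A \<odot>\<^sub>h e1 (south B))) \<odot>\<^sub>h e1 (south A)"
    by (subst interchange) (simp_all add: edge.assoc)
  then have 3: "(?X \<odot>\<^sub>h e1 (south A)) \<odot>\<^sub>v folding A = e1 (west A \<odot> south A)"
    by (simp add: 1 e1_ec flip: pA)
  have "(e1 (north A) \<odot>\<^sub>h (e1 (north B) \<odot>\<^sub>h folding A)) \<odot>\<^sub>v (e1 (north A) \<odot>\<^sub>h ?Y) = e1 (north A) \<odot>\<^sub>h ((e1 (north B) \<odot>\<^sub>h folding A) \<odot>\<^sub>v ?Y)"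
    by (subst interchange) (simp_all add: edge.assoc)
  then have 4: "folding A \<odot>\<^sub>v (e1 (north A) \<odot>\<^sub>h ?Y) = e1 (north A \<odot> east A)"
    by (simp add: 2 e1_ec flip: pA')
  have "north A \<odot> (north B \<odot> (east B \<odot> south A)) = (north A \<odot> north B) \<odot> (east B \<odot> south A)"
    by (simp add: edge.assoc)
  then have "north A \<odot> (north B \<odot> (east B \<odot> south A)) = east B \<odot> south A"
    using n(5) by simp
  then have "vert.inverse_arrows (folding A) (e1 (north A) \<odot>\<^sub>h folding B \<odot>\<^sub>h e1 (south A))"
    using 3 4 s(6) by (simp add: vert.inverse_arrows_def horiz.assoc edge.assoc)
  then show ?thesis using vert.invertible_def by blast
qed

text \<open>A horizontal inverse must have north and south sides inverse to those of
  \<open>A\<close>; with such sides given, it is constructed by \<open>unfold\<close>, and the two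
  equations are checked on foldings by \<open>folding_inject\<close>.\<close>

lemma horiz_invertible_if_folding:
  assumes [simp]: "A \<in> S" and inv: "vert.invertible (folding A)"
    and "edge.invertible (north A)" "edge.invertible (south A)"
  shows "horiz.invertible A"
proof -
  define u v c d where "u = north A" and "v = south A" and "c = west A" and "d = east A"
  note uvcd = this
  obtain D where D: "vert.inverse_arrows (folding A) D" using inv by (auto simp: vert.invertible_def)
  obtain u' v' where u': "edge.inverse_arrows u u'" and v': "edge.inverse_arrows v v'"
    using assms(3,4) by (auto simp: edge.invertible_def uvcd)
  note u = edge.inverse_arrowsD[OF u'] and v = edge.inverse_arrowsD[OF v']
  note Di = vert.inverse_arrowsD[OF D]
  have edges [simp]: "c \<in> E" "d \<in> E" "src c = src u" "tgt c = src v" "src d = tgt u" "tgt d = tgt v"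
    by (simp_all add: uvcd)
  note [simp] = u(1,2) v(1,2) u(3,4)[symmetric] v(3,4)[symmetric]
  have A [simp]: "north A = u" "south A = v" "west A = c" "east A = d"
    by (simp_all add: uvcd)
  have D' [simp]: "D \<in> S" "north D = c \<odot> v" "south D = u \<odot> d"
    using Di(2-4) by simp_all
  \<comment> \<open>The west and east sides of \<open>folding A\<close> are identities, so those of
    its inverse are inverse to identities and hence identities too.\<close>
  have "edge.inverse_arrows (one (src u)) (west D)" "edge.inverse_arrows (one (tgt v)) (east D)"
    using inverse_faces_v[OF D] by simp_all
  then have [simp]: "west D = one (src u)" "east D = one (tgt v)"
    using edge.inverse_arrows_unique edge.inverse_arrows_one by (metis edge.src_closed edge.tgt_closed u(1) v(1))+
  \<comment> \<open>The inverse square has north \<open>u'\<close>, east \<open>c\<close>, west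
    \<open>d\<close>, south \<open>v'\<close>, so its folding must run from
    \<open>u' \<odot> c\<close> to \<open>d \<odot> v'\<close>. As \<open>D\<close> runs from
    \<open>c \<odot> v\<close> to \<open>u \<odot> d\<close>, whiskering by \<open>u'\<close> and
    \<open>v'\<close> gives such a square.\<close>
  define Z where "Z = e1 u' \<odot>\<^sub>h D \<odot>\<^sub>h e1 v'"
  have e: "e1 u \<odot>\<^sub>h e1 u' = e1 (one (src u))" "e1 u' \<odot>\<^sub>h e1 u = e1 (one (tgt u))"
    "e1 v \<odot>\<^sub>h e1 v' = e1 (one (src v))" "e1 v' \<odot>\<^sub>h e1 v = e1 (one (tgt v))"
    using e1_ec[of u u'] e1_ec[of u' u] e1_ec[of v v'] e1_ec[of v' v] u(5,6) v(5,6) by simp_all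
  have "u' \<odot> (u \<odot> d) \<odot> v' = u' \<odot> u \<odot> d \<odot> v'" "u' \<odot> (c \<odot> v) \<odot> v' = u' \<odot> c \<odot> (v \<odot> v')"
    by (simp_all add: edge.assoc)
  then have Zf [simp]: "Z \<in> S" "north Z = u' \<odot> c" "south Z = d \<odot> v'" "west Z = one (src u')" "east Z = one (tgt v')"
    using u(6) v(5) by (simp_all add: Z_def)
  have "e1 u \<odot>\<^sub>h Z = e1 u \<odot>\<^sub>h e1 u' \<odot>\<^sub>h D \<odot>\<^sub>h e1 v'"
    by (simp add: Z_def horiz.assoc)
  then have Zu: "e1 u \<odot>\<^sub>h Z = D \<odot>\<^sub>h e1 v'" using e(1) by simp
  have "Z \<odot>\<^sub>h e1 v = e1 u' \<odot>\<^sub>h D \<odot>\<^sub>h (e1 v' \<odot>\<^sub>h e1 v)"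
    by (simp add: Z_def horiz.assoc)
  then have Zv: "Z \<odot>\<^sub>h e1 v = e1 u' \<odot>\<^sub>h D" using e(4) by simp
  define B where "B = unfold u' d c v' Z"
  have B [simp]: "B \<in> S" "north B = u'" "west B = d" "east B = c" "south B = v'" "folding B = Z"
    unfolding B_def by (rule unfold_props; simp)+
  have "folding (A \<odot>\<^sub>h B) = (D \<odot>\<^sub>h e1 v') \<odot>\<^sub>v (folding A \<odot>\<^sub>h e1 v')"
    by (simp add: folding_hc Zu)
  also have "\<dots> = e1 (c \<odot> v) \<odot>\<^sub>h e1 v'"
    using Di(6) by (subst interchange) simp_all
  also have "\<dots> = e1 c"
    by (simp add: e1_ec horiz.assoc e)
  finally have "folding (A \<odot>\<^sub>h B) = folding (e2 c)" by simp
  then have 1: "A \<odot>\<^sub>h B = e2 c"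
    using folding_inject[of "A \<odot>\<^sub>h B" "e2 c"] u(5) v(5) by simp
  have "folding (B \<odot>\<^sub>h A) = (e1 u' \<odot>\<^sub>h folding A) \<odot>\<^sub>v (e1 u' \<odot>\<^sub>h D)"
    by (simp add: folding_hc Zv)
  also have "\<dots> = e1 u' \<odot>\<^sub>h e1 (u \<odot> d)"
    using Di(5) by (subst interchange) simp_all
  also have "\<dots> = e1 d"
    by (simp add: e1_ec e flip: horiz.assoc)
  finally have "folding (B \<odot>\<^sub>h A) = folding (e2 d)" by simp
  then have 2: "B \<odot>\<^sub>h A = e2 d"
    using folding_inject[of "B \<odot>\<^sub>h A" "e2 d"] u(6) v(6) by simp
  have "horiz.inverse_arrows A B" using 1 2 by (simp add: horiz.inverse_arrows_def)
  then show ?thesis using horiz.invertible_def by blast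
qed

section \<open>Transposed squares and T-inverses\<close>

definition transposed :: "'s \<Rightarrow> 's \<Rightarrow> bool" where
  "transposed A B \<longleftrightarrow> A \<in> S \<and> B \<in> S \<and> north A = west B \<and> west A = north B \<and>
     south A = east B \<and> east A = south B"

definition T_eq :: "'s \<Rightarrow> 's \<Rightarrow> bool" where
  "T_eq A B \<longleftrightarrow>
     (gp (west A) \<odot>\<^sub>v B) \<odot>\<^sub>h (A \<odot>\<^sub>v gm (south A)) = gm (north A) \<odot>\<^sub>v gp (east A)"

text \<open>Both sides of the equation have the same four sides, so they are equal as soon as their
  foldings are. Connections fold to units, hence the left side folds to the vertical composite of
  the two foldings and the right side to a unit.\<close>

lemma T_eq_iff_folding:
  assumes "transposed A B"
  shows "T_eq A B \<longleftrightarrow> folding A \<odot>\<^sub>v folding B = e1 (north (folding A))"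
proof -
  define u v c d where "u = north A" and "v = south A" and "c = west A" and "d = east A"
  note uvcd = this
  have [simp]: "A \<in> S" "B \<in> S"
    using assms by (simp_all add: transposed_def)
  have edges [simp]: "u \<in> E" "v \<in> E" "c \<in> E" "d \<in> E"
    "src c = src u" "tgt c = src v" "src d = tgt u" "tgt d = tgt v"
    by (simp_all add: uvcd)
  have [simp]: "north A = u" "west A = c" "south A = v" "east A = d"
    "west B = u" "north B = c" "east B = v" "south B = d"
    using assms by (simp_all add: transposed_def uvcd)
  let ?L = "(gp c \<odot>\<^sub>v B) \<odot>\<^sub>h (A \<odot>\<^sub>v gm v)" and ?R = "gm u \<odot>\<^sub>v gp d"
  have "folding (gp c \<odot>\<^sub>v B) = folding B"
    by (simp add: folding_vc flip: e1_ec)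
  moreover have "folding (A \<odot>\<^sub>v gm v) = folding A"
    by (simp add: folding_vc flip: e1_ec)
  ultimately have L: "folding ?L = folding A \<odot>\<^sub>v folding B"
    by (simp add: folding_hc)
  have R: "folding ?R = e1 (u \<odot> d)"
    by (simp add: folding_vc flip: e1_ec)
  have "?L = ?R \<longleftrightarrow> folding ?L = folding ?R"
    using folding_inject[of ?L ?R] by auto
  then show ?thesis using L R by (simp add: T_eq_def)
qed

lemma transposed_sym: "transposed A B \<Longrightarrow> transposed B A"
  by (auto simp: transposed_def)

lemma T_invertible_iff_folding:
  assumes [simp]: "A \<in> S"
  shows "(\<exists>B. transposed A B \<and> T_eq A B \<and> T_eq B A) \<longleftrightarrow> vert.invertible (folding A)"
proof
  assume "\<exists>B. transposed A B \<and> T_eq A B \<and> T_eq B A"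
  then obtain B where B: "transposed A B" "T_eq A B" "T_eq B A" by blast
  then have "folding A \<odot>\<^sub>v folding B = e1 (north (folding A))" "folding B \<odot>\<^sub>v folding A = e1 (north (folding B))"
    using T_eq_iff_folding transposed_sym by blast+
  then have "vert.inverse_arrows (folding A) (folding B)"
    using B(1) by (simp add: vert.inverse_arrows_def transposed_def)
  then show "vert.invertible (folding A)" using vert.invertible_def by blast
next
  assume "vert.invertible (folding A)"
  then obtain D where D: "vert.inverse_arrows (folding A) D" by (auto simp: vert.invertible_def)
  note Di = vert.inverse_arrowsD[OF D]
  have "edge.inverse_arrows (one (src (north A))) (west D)" "edge.inverse_arrows (one (tgt (south A))) (east D)"
    using inverse_faces_v[OF D] by simp_all
  then have we: "west D = one (src (north A))" "east D = one (tgt (south A))"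
    using edge.inverse_arrows_unique edge.inverse_arrows_one
    by (metis assms edge.src_closed edge.tgt_closed vert.src_closed vert.tgt_closed)+
  \<comment> \<open>The sides of \<open>A\<close> are exchanged across the diagonal, and
    \<open>D\<close> has the right boundary because it runs from
    \<open>west A \<odot> south A\<close> to \<open>north A \<odot> east A\<close>.\<close>
  define B where "B = unfold (west A) (north A) (south A) (east A) D"
  have B [simp]: "B \<in> S" "north B = west A" "west B = north A" "east B = south A" "south B = east A" "folding B = D"
    unfolding B_def by (rule unfold_props; use Di(2-4) we in simp)+
  have t: "transposed A B" by (simp add: transposed_def)
  have "T_eq A B" using T_eq_iff_folding[OF t] Di by simp
  moreover have "T_eq B A" using T_eq_iff_folding[OF transposed_sym[OF t]] Di by simp
  ultimately show "\<exists>B. transposed A B \<and> T_eq A B \<and> T_eq B A" using t by blast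
qed

end

subsection \<open>Invertibility in one direction\<close>

definition R_inverses :: "'a cubical_data \<Rightarrow> nat \<Rightarrow> nat \<Rightarrow> 'a \<Rightarrow> 'a \<Rightarrow> bool" where
  "R_inverses C n i A B \<longleftrightarrow> composable C n i A B \<and> composable C n i B A \<and>
     cmp C n i A B = degen C (n - 1) i (face C n i Minus A) \<and>
     cmp C n i B A = degen C (n - 1) i (face C n i Plus A)"

definition R_invertible :: "'a cubical_data \<Rightarrow> nat \<Rightarrow> nat \<Rightarrow> 'a \<Rightarrow> bool" where
  "R_invertible C n i A \<longleftrightarrow> (\<exists>B. R_inverses C n i A B)"

lemma R1_invertible_iff: "R1_invertible C n A \<longleftrightarrow> R_invertible C n 1 A"
  by (simp add: R1_invertible_def R_invertible_def R_inverses_def)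

text \<open>Keeps \<open>n - 1\<close> and \<open>i + 1\<close> in the form in which the axioms
  state them.\<close>

declare One_nat_def [simp del]

lemma R_invertibleI: "R_inverses C n i A B \<Longrightarrow> R_invertible C n i A"
  by (auto simp: R_invertible_def)

locale cubical_omega = cubical_category \<infinity> C for C :: "'a cubical_data"
begin

text \<open>A second name for the cubical law: where a \<open>cubical_plane\<close> is interpreted,
  \<open>interchange\<close> refers to the law of its double category.\<close>

lemmas cmp_interchange = interchange

lemma face_face_general:
  assumes "A \<in> cells C n" "1 \<le> i" "i \<le> n" "1 \<le> m" "m \<le> n" "i \<noteq> m"
  shows "face C (n - 1) (down i m) \<alpha> (face C n i \<beta> A) =
    face C (n - 1) (down m i) \<beta> (face C n m \<alpha> A)"
proof (cases "i < m")
  case True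
  then show ?thesis using face_face[of n i m A \<alpha> \<beta>] assms by (simp add: down_def)
next
  case False
  then show ?thesis using face_face[of n m i A \<beta> \<alpha>] assms by (simp add: down_def)
qed

lemma degen_degen_general:
  assumes "A \<in> cells C n" "1 \<le> i" "i \<le> n + 1" "1 \<le> m" "m \<le> n + 2"
  shows "degen C (n + 1) m (degen C n i A) =
    degen C (n + 1) (up m i) (degen C n (down (up m i) m) A)"
proof (cases "i < m")
  case True
  then show ?thesis using degen_degen[of n i "m - 1" A] assms by (simp add: up_def down_def)
next
  case False
  then show ?thesis using degen_degen[of n m i A] assms by (simp add: up_def down_def)
qed

lemma composable_iff:
  "composable C n i A B \<longleftrightarrow> A \<in> cells C n \<and> B \<in> cells C n \<and> 1 \<le> i \<and> i \<le> n \<and>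
    face C n i Plus A = face C n i Minus B"
  by (simp add: composable_def)

lemma partial_category_direction:
  assumes "1 \<le> i" "i \<le> n"
  shows "partial_category (cells C (n - 1)) (cells C n) (face C n i Minus) (face C n i Plus)
    (degen C (n - 1) i) (cmp C n i)"
  using assms face_degen_same[of "n - 1" i] degen_closed[of "n - 1" i] face_closed[of n i]
  by unfold_locales
    (auto simp: composable_iff cmp_closed face_cmp_minus face_cmp_plus cmp_assoc
      cmp_unit_left cmp_unit_right)

lemma R_inverses_iff:
  assumes "1 \<le> i" "i \<le> n"
  shows "R_inverses C n i A B \<longleftrightarrow> partial_category.inverse_arrows (cells C n)
    (face C n i Minus) (face C n i Plus) (degen C (n - 1) i) (cmp C n i) A B"
  unfolding partial_category.inverse_arrows_def[OF partial_category_direction[OF assms]]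
  using assms by (auto simp: R_inverses_def composable_iff)

lemma R_invertible_iff:
  assumes "1 \<le> i" "i \<le> n"
  shows "R_invertible C n i A \<longleftrightarrow> partial_category.invertible (cells C n)
    (face C n i Minus) (face C n i Plus) (degen C (n - 1) i) (cmp C n i) A"
  unfolding partial_category.invertible_def[OF partial_category_direction[OF assms]]
  by (simp only: R_invertible_def R_inverses_iff[OF assms])

lemma R_inverses_unique: "\<lbrakk>R_inverses C n i A B; R_inverses C n i A D\<rbrakk> \<Longrightarrow> B = D"
  using R_inverses_iff[of i n A] partial_category.inverse_arrows_unique[OF partial_category_direction]
  by (metis R_inverses_def composable_def)

section \<open>Operations preserving invertibility in one direction\<close>

lemma R_invertible_degen:
  "\<lbrakk>1 \<le> i; i \<le> n + 1; A \<in> cells C n\<rbrakk> \<Longrightarrow> R_invertible C (n + 1) i (degen C n i A)"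
  using partial_category.invertible_one[OF partial_category_direction[of i "n + 1"], of A]
  by (simp add: R_invertible_iff)

lemma R_invertible_cmp_same:
  "\<lbrakk>R_invertible C n i A; R_invertible C n i B; composable C n i A B\<rbrakk>
    \<Longrightarrow> R_invertible C n i (cmp C n i A B)"
  using partial_category.invertible_comp[OF partial_category_direction[of i n]]
  by (simp add: R_invertible_iff composable_iff)

lemma R_inverses_face:
  assumes "R_inverses C n i A B" "1 \<le> m" "m \<le> n" "m \<noteq> i"
  shows "R_inverses C (n - 1) (down m i) (face C n m \<alpha> A) (face C n m \<alpha> B)"
proof -
  have AB: "A \<in> cells C n" "B \<in> cells C n" "1 \<le> i" "i \<le> n"
    and comp: "composable C n i A B" "composable C n i B A"
    using assms by (auto simp: R_inverses_def composable_iff)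
  have n: "n - 1 + 1 = n" "Suc (n - Suc 0) = n" using AB by auto
  have d: "1 \<le> down m i" "down m i \<le> n - 1" "1 \<le> down i m" "down i m \<le> n - 1"
    using assms AB by (auto simp: down_def)
  have ff: "face C (n - 1) (down m i) \<beta> (face C n m \<alpha> X) =
     face C (n - 1) (down i m) \<alpha> (face C n i \<beta> X)" if "X \<in> cells C n" for X \<beta>
    using face_face_general[of X n m i \<beta> \<alpha>] assms AB that by simp
  have c: "composable C (n - 1) (down m i) (face C n m \<alpha> A) (face C n m \<alpha> B)"
    "composable C (n - 1) (down m i) (face C n m \<alpha> B) (face C n m \<alpha> A)"
    using comp AB assms(2-) d by (simp_all add: composable_iff face_closed ff)
  have deg: "face C n m \<alpha> (degen C (n - 1) i (face C n i \<beta> X)) =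
    degen C (n - 2) (down m i) (face C (n - 1) (down m i) \<beta> (face C n m \<alpha> X))"
    if "X \<in> cells C n" for X \<beta>
    using face_degen[of "n - 1" m i "face C n i \<beta> X" \<alpha>] that AB assms(2-) n
    by (simp add: face_closed ff numeral_2_eq_2)
  have "cmp C (n - 1) (down m i) (face C n m \<alpha> A) (face C n m \<alpha> B) = face C n m \<alpha> (cmp C n i A B)"
    "cmp C (n - 1) (down m i) (face C n m \<alpha> B) (face C n m \<alpha> A) = face C n m \<alpha> (cmp C n i B A)"
    using face_cmp[of n m i] assms(2-) comp by simp_all
  then show ?thesis
    using assms(1) c deg AB by (simp add: R_inverses_def numeral_2_eq_2)
qed

lemma R_invertible_face:
  "\<lbrakk>R_invertible C n i A; 1 \<le> m; m \<le> n; m \<noteq> i\<rbrakk>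
    \<Longrightarrow> R_invertible C (n - 1) (down m i) (face C n m \<alpha> A)"
  using R_inverses_face R_invertible_def by meson

lemma R_invertible_cmp:
  assumes "R_invertible C n i A" "R_invertible C n i B" "composable C n m A B"
  shows "R_invertible C n i (cmp C n m A B)"
proof (cases "m = i")
  case True
  then show ?thesis using assms R_invertible_cmp_same by simp
next
  case m: False
  obtain A' B' where A': "R_inverses C n i A A'" and B': "R_inverses C n i B B'"
    using assms by (auto simp: R_invertible_def)
  have A: "A \<in> cells C n" "A' \<in> cells C n" "B \<in> cells C n" "B' \<in> cells C n" "1 \<le> i" "i \<le> n" "1 \<le> m" "m \<le> n"
    using A' B' assms by (auto simp: R_inverses_def composable_iff)
  \<comment> \<open>The inverses are composable in direction \<open>m\<close>: their faces on the
    common boundary are both inverse to the same face of \<open>A\<close> and \<open>B\<close>, and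
    inverses are unique.\<close>
  have "face C n m Plus A' = face C n m Minus B'"
    using R_inverses_face[OF A', of m Plus] R_inverses_face[OF B', of m Minus] R_inverses_unique assms m A
    by (simp add: composable_iff)
  then have c': "composable C n m A' B'" using A by (simp add: composable_iff)
  have i: "composable C n i A A'" "composable C n i A' A" "composable C n i B B'" "composable C n i B' B"
    using A' B' by (auto simp: R_inverses_def)
  have f: "face C n i \<alpha> (cmp C n m A B) = cmp C (n - 1) (down i m) (face C n i \<alpha> A) (face C n i \<alpha> B)"
    "face C n i \<alpha> (cmp C n m A' B') = cmp C (n - 1) (down i m) (face C n i \<alpha> A') (face C n i \<alpha> B')" for \<alpha>
    using assms c' A m by (simp_all add: face_cmp)
  have cf: "composable C (n - 1) (down i m) (face C n i \<alpha> X) (face C n i \<alpha> Y)"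
    if "composable C n m X Y" for X Y \<alpha>
    using that A m face_face_general[of X n i m Plus \<alpha>] face_face_general[of Y n i m Minus \<alpha>]
    by (auto simp: composable_iff face_closed) (auto simp: down_def)
  have u: "up i (down i m) = m" using m A by (auto simp: up_def down_def)
  have dg: "degen C (n - 1) i (cmp C (n - 1) (down i m) (face C n i \<alpha> X) (face C n i \<alpha> Y)) =
     cmp C n m (degen C (n - 1) i (face C n i \<alpha> X)) (degen C (n - 1) i (face C n i \<alpha> Y))"
    if "composable C n m X Y" for X Y \<alpha>
    using degen_cmp[of "n - 1" i "down i m", OF _ _ _ cf[OF that]] A u by simp
  note dg = dg[OF assms(3)] dg[OF c']
  have "cmp C n i (cmp C n m A B) (cmp C n m A' B') = cmp C n m (cmp C n i A A') (cmp C n i B B')"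
    "cmp C n i (cmp C n m A' B') (cmp C n m A B) = cmp C n m (cmp C n i A' A) (cmp C n i B' B)"
    using interchange[of n m i] assms(3) c' i m by simp_all
  then have "R_inverses C n i (cmp C n m A B) (cmp C n m A' B')"
    using A' B' A f assms(3) c' i by (simp add: R_inverses_def composable_iff dg cmp_closed)
  then show ?thesis by (rule R_invertibleI)
qed

text \<open>Gamma_m with \<open>m\<close> different from \<open>i\<close> respects composition in
  direction \<open>i\<close> and its units, hence carries inverses to inverses;
  \<open>up m i\<close> is the position of direction \<open>i\<close> one dimension higher.\<close>

lemma R_invertible_conn:
  assumes "R_invertible C n i A" "1 \<le> m" "m \<le> n" "m \<noteq> i"
  shows "R_invertible C (n + 1) (up m i) (conn C n m \<alpha> A)"
proof -
  obtain B where B: "R_inverses C n i A B" using assms by (auto simp: R_invertible_def)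
  have AB: "A \<in> cells C n" "B \<in> cells C n" "1 \<le> i" "i \<le> n"
    and comp: "composable C n i A B" "composable C n i B A"
    using B by (auto simp: R_inverses_def composable_iff)
  have u: "1 \<le> up m i" "up m i \<le> n + 1" "up m i \<noteq> m" "up m i \<noteq> m + 1"
    "down m (up m i) = i" "down (up m i) m = down i m"
    using assms AB by (auto simp: up_def down_def)
  have n: "n - 1 + 1 = n" using AB by simp
  have ff: "face C (n + 1) (up m i) \<beta> (conn C n m \<alpha> X) = conn C (n - 1) (down i m) \<alpha> (face C n i \<beta> X)"
    if "X \<in> cells C n" for X \<beta>
    using face_conn[of n "up m i" m X \<beta> \<alpha>] that u assms by simp
  have deg: "conn C n m \<alpha> (degen C (n - 1) i (face C n i \<beta> A)) =
    degen C n (up m i) (face C (n + 1) (up m i) \<beta> (conn C n m \<alpha> A))" for \<beta>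
    using conn_degen[of "n - 1" m i "face C n i \<beta> A" \<alpha>] AB assms(2-) n
    by (simp add: face_closed ff)
  have "composable C (n + 1) (up m i) (conn C n m \<alpha> A) (conn C n m \<alpha> B)"
    "composable C (n + 1) (up m i) (conn C n m \<alpha> B) (conn C n m \<alpha> A)"
    using comp AB assms(2-) u by (simp_all add: composable_iff ff) (simp_all add: conn_closed)
  then have "R_inverses C (n + 1) (up m i) (conn C n m \<alpha> A) (conn C n m \<alpha> B)"
    using conn_cmp[of n m i A B \<alpha>] conn_cmp[of n m i B A \<alpha>] comp assms(2-) B deg
    by (simp add: R_inverses_def)
  then show ?thesis by (rule R_invertibleI)
qed

lemma R_invertible_degen_any:
  assumes "R_invertible C n i A" "1 \<le> m" "m \<le> n + 1"
  shows "R_invertible C (n + 1) (up m i) (degen C n m A)"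
proof -
  obtain B where B: "R_inverses C n i A B" using assms by (auto simp: R_invertible_def)
  have AB: "A \<in> cells C n" "B \<in> cells C n" "1 \<le> i" "i \<le> n"
    and comp: "composable C n i A B" "composable C n i B A"
    using B by (auto simp: R_inverses_def composable_iff)
  have u: "1 \<le> up m i" "up m i \<le> n + 1" "up m i \<noteq> m" "down m (up m i) = i"
    using assms AB by (auto simp: up_def down_def)
  have n: "n - 1 + 1 = n" using AB by simp
  have ff: "face C (n + 1) (up m i) \<beta> (degen C n m X) = degen C (n - 1) (down (up m i) m) (face C n i \<beta> X)"
    if "X \<in> cells C n" for X \<beta>
    using face_degen[of n "up m i" m X \<beta>] that u assms by simp
  have deg: "degen C n m (degen C (n - 1) i (face C n i \<beta> A)) =
    degen C n (up m i) (face C (n + 1) (up m i) \<beta> (degen C n m A))" for \<beta>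
    using degen_degen_general[of "face C n i \<beta> A" "n - 1" i m] AB assms(2-) n
    by (simp add: face_closed ff)
  have "composable C (n + 1) (up m i) (degen C n m A) (degen C n m B)"
    "composable C (n + 1) (up m i) (degen C n m B) (degen C n m A)"
    using comp AB assms(2-) u by (simp_all add: composable_iff ff) (simp_all add: degen_closed)
  then have "R_inverses C (n + 1) (up m i) (degen C n m A) (degen C n m B)"
    using degen_cmp[of n m i A B] degen_cmp[of n m i B A] comp assms(2-) B deg
    by (simp add: R_inverses_def)
  then show ?thesis by (rule R_invertibleI)
qed

text \<open>Stated with successors, so that no truncated subtraction enters the verification; the
  sublocale of \<open>cubical_plane\<close> translates it to squares of dimension
  \<open>n\<close>.\<close>

lemma double_category_plane:
  assumes "1 \<le> i" "i \<le> Suc n"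
  shows "double_category (cells C n) (cells C (Suc n))
    (face C (Suc n) i Minus) (face C (Suc n) i Plus) (degen C n i) (cmp C (Suc n) i)
    (cells C (Suc (Suc n)))
    (face C (Suc (Suc n)) i Minus) (face C (Suc (Suc n)) i Plus)
    (face C (Suc (Suc n)) (Suc i) Minus) (face C (Suc (Suc n)) (Suc i) Plus)
    (degen C (Suc n) i) (degen C (Suc n) (Suc i))
    (cmp C (Suc (Suc n)) i) (cmp C (Suc (Suc n)) (Suc i))
    (conn C (Suc n) i Plus) (conn C (Suc n) i Minus)"
proof -
  interpret edge: partial_category "cells C n" "cells C (Suc n)" "face C (Suc n) i Minus"
    "face C (Suc n) i Plus" "degen C n i" "cmp C (Suc n) i"
    using partial_category_direction[of i "Suc n"] assms by simp
  interpret vert: partial_category "cells C (Suc n)" "cells C (Suc (Suc n))" "face C (Suc (Suc n)) i Minus"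
    "face C (Suc (Suc n)) i Plus" "degen C (Suc n) i" "cmp C (Suc (Suc n)) i"
    using partial_category_direction[of i "Suc (Suc n)"] assms by simp
  interpret horiz: partial_category "cells C (Suc n)" "cells C (Suc (Suc n))" "face C (Suc (Suc n)) (Suc i) Minus"
    "face C (Suc (Suc n)) (Suc i) Plus" "degen C (Suc n) (Suc i)" "cmp C (Suc (Suc n)) (Suc i)"
    using partial_category_direction[of "Suc i" "Suc (Suc n)"] assms by simp
  have ff: "face C (Suc n) i \<alpha> (face C (Suc (Suc n)) (Suc i) \<beta> A) = face C (Suc n) i \<beta> (face C (Suc (Suc n)) i \<alpha> A)"
    if "A \<in> cells C (Suc (Suc n))" for A \<alpha> \<beta>
    using face_face[of "Suc (Suc n)" i "Suc i" A \<beta> \<alpha>] assms that by (simp add: One_nat_def)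
  have conn_c: "conn C (Suc n) i \<alpha> f \<in> cells C (Suc (Suc n))" if "f \<in> cells C (Suc n)" for f \<alpha>
    using conn_closed[of "Suc n" i f \<alpha>] assms that by (simp add: One_nat_def)
  show ?thesis
    \<comment> \<open>The three categories are already interpreted, so the goals are the remaining
      assumptions of \<open>double_category\<close> in their order. Apart from closure and the
      corner identities, each is a single cubical axiom for the directions \<open>i\<close> and
      \<open>Suc i\<close>.\<close>
    apply unfold_locales
    subgoal by (simp add: One_nat_def ff)
    subgoal by (simp add: One_nat_def ff)
    subgoal for A using ff[of A Plus Minus] by (simp add: One_nat_def)
    subgoal by (simp add: One_nat_def ff)
    subgoal for A B using face_cmp[of "Suc (Suc n)" "Suc i" i A B] assms by (simp add: One_nat_def composable_iff down_def)
    subgoal for A B using face_cmp[of "Suc (Suc n)" "Suc i" i A B] assms by (simp add: One_nat_def composable_iff down_def)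
    subgoal for A B using face_cmp[of "Suc (Suc n)" i "Suc i" A B] assms by (simp add: One_nat_def composable_iff down_def)
    subgoal for A B using face_cmp[of "Suc (Suc n)" i "Suc i" A B] assms by (simp add: One_nat_def composable_iff down_def)
    subgoal for f using face_degen[of "Suc n" "Suc i" i f] assms by (simp add: One_nat_def down_def)
    subgoal for f using face_degen[of "Suc n" "Suc i" i f] assms by (simp add: One_nat_def down_def)
    subgoal for f using face_degen[of "Suc n" i "Suc i" f] assms by (simp add: One_nat_def down_def)
    subgoal for f using face_degen[of "Suc n" i "Suc i" f] assms by (simp add: One_nat_def down_def)
    subgoal for f g using degen_cmp[of "Suc n" i i f g] assms by (simp add: One_nat_def composable_iff up_def)
    subgoal for f g using degen_cmp[of "Suc n" "Suc i" i f g] assms by (simp add: One_nat_def composable_iff up_def)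
    subgoal for x using degen_degen[of n i i x] assms by (simp add: One_nat_def)
    subgoal for A B D F using interchange[of "Suc (Suc n)" "Suc i" i A B D F] assms by (simp add: One_nat_def composable_iff)
    subgoal using conn_c by (simp add: One_nat_def)
    subgoal using conn_c by (simp add: One_nat_def)
    subgoal for f using face_conn_opposite[of "Suc n" i i Plus Minus f] assms by (simp add: One_nat_def)
    subgoal for f using face_conn_opposite[of "Suc n" i "Suc i" Plus Minus f] assms by (simp add: One_nat_def)
    subgoal for f using face_conn_same[of "Suc n" i i f Plus] assms by (simp add: One_nat_def)
    subgoal for f using face_conn_same[of "Suc n" i "Suc i" f Plus] assms by (simp add: One_nat_def)
    subgoal for f using face_conn_same[of "Suc n" i i f Minus] assms by (simp add: One_nat_def)
    subgoal for f using face_conn_same[of "Suc n" i "Suc i" f Minus] assms by (simp add: One_nat_def)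
    subgoal for f using face_conn_opposite[of "Suc n" i i Minus Plus f] assms by (simp add: One_nat_def)
    subgoal for f using face_conn_opposite[of "Suc n" i "Suc i" Minus Plus f] assms by (simp add: One_nat_def)
    subgoal for f g using conn_minus_cmp[of "Suc n" i f g] assms by (simp add: One_nat_def composable_iff)
    subgoal for f g using conn_plus_cmp[of "Suc n" i f g] assms by (simp add: One_nat_def composable_iff)
    subgoal for f using cmp_conn_conn[of "Suc n" i f] assms by (simp add: One_nat_def)
    subgoal for f using cmp_conn_conn_next[of "Suc n" i f] assms by (simp add: One_nat_def)
    subgoal for x using conn_degen_same[of n i x Plus] assms by (simp add: One_nat_def)
    subgoal for x using conn_degen_same[of n i x Minus] assms by (simp add: One_nat_def)
    done
qed

end

subsection \<open>The double category of two adjacent directions\<close>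

lemma all_sign_iff: "(\<forall>\<alpha>. P \<alpha>) \<longleftrightarrow> P Minus \<and> P Plus"
  by (metis sign.exhaust)

locale cubical_plane = cubical_omega C for C :: "'a cubical_data" +
  fixes n i :: nat
  assumes i_pos: "1 \<le> i" and i_less: "i < n"

sublocale cubical_plane \<subseteq> double_category "cells C (n - 2)" "cells C (n - 1)"
    "face C (n - 1) i Minus" "face C (n - 1) i Plus" "degen C (n - 2) i" "cmp C (n - 1) i"
    "cells C n" "face C n i Minus" "face C n i Plus" "face C n (i + 1) Minus" "face C n (i + 1) Plus"
    "degen C (n - 1) i" "degen C (n - 1) (i + 1)" "cmp C n i" "cmp C n (i + 1)"
    "conn C (n - 1) i Plus" "conn C (n - 1) i Minus"
proof -
  have "Suc (n - 2) = n - 1" "Suc (Suc (n - 2)) = n" using i_pos i_less by auto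
  then show "double_category (cells C (n - 2)) (cells C (n - 1))
    (face C (n - 1) i Minus) (face C (n - 1) i Plus) (degen C (n - 2) i) (cmp C (n - 1) i)
    (cells C n) (face C n i Minus) (face C n i Plus) (face C n (i + 1) Minus) (face C n (i + 1) Plus)
    (degen C (n - 1) i) (degen C (n - 1) (i + 1)) (cmp C n i) (cmp C n (i + 1))
    (conn C (n - 1) i Plus) (conn C (n - 1) i Minus)"
    using double_category_plane[of i "n - 2"] i_pos i_less by (simp flip: Suc_eq_plus1)
qed

context cubical_plane
begin

lemma index_bounds [simp]: "1 \<le> i" "i < n" "i \<le> n" "i \<le> n - 1" "i + 1 \<le> n"
  using i_pos i_less by auto

lemma folding_eq: "folding A = psi C n i A"
  by (simp add: folding_def psi_def)

lemma vert_invertible_iff: "vert.invertible A \<longleftrightarrow> R_invertible C n i A"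
  by (simp add: R_invertible_iff)

lemma horiz_invertible_iff: "horiz.invertible A \<longleftrightarrow> R_invertible C n (i + 1) A"
  by (simp add: R_invertible_iff)

lemma edge_invertible_iff: "edge.invertible f \<longleftrightarrow> R_invertible C (n - 1) i f"
  by (simp add: R_invertible_iff diff_diff_eq)

lemma T_equation_iff: "T_equation C n i A B \<longleftrightarrow> T_eq A B"
  by (simp add: T_equation_def T_eq_def)

lemma is_T_inverse_iff: "is_T_inverse C n i A B \<longleftrightarrow> transposed A B \<and> T_eq A B \<and> T_eq B A"
  by (auto simp: is_T_inverse_def transposed_def all_sign_iff T_equation_iff)

lemma T_invertible_iff:
  "A \<in> cells C n \<Longrightarrow> T_invertible C n i A \<longleftrightarrow> R_invertible C n i (psi C n i A)"
  using T_invertible_iff_folding[of A]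
  by (simp add: T_invertible_def is_T_inverse_iff folding_eq vert_invertible_iff)

lemma psi_composable:
  assumes "A \<in> cells C n"
  shows "composable C n (i + 1) (conn C (n - 1) i Plus (face C n (i + 1) Minus A)) A"
    "composable C n (i + 1) (cmp C n (i + 1) (conn C (n - 1) i Plus (face C n (i + 1) Minus A)) A)
      (conn C (n - 1) i Minus (face C n (i + 1) Plus A))"
  using assms by (simp_all add: composable_iff)

lemmas psi_cell = folding_closed[unfolded folding_eq]
lemmas face_psi_i_Minus = north_folding[unfolded folding_eq]
lemmas face_psi_i_Plus = south_folding[unfolded folding_eq]
lemmas face_psi_next_Minus = west_folding[unfolded folding_eq]
lemmas face_psi_next_Plus = east_folding[unfolded folding_eq]

lemma T_invertible_cmp_i:
  assumes "T_invertible C n i A" "T_invertible C n i B" "composable C n i A B"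
  shows "T_invertible C n i (cmp C n i A B)"
  using assms invertible_folding_vc[of A B] T_invertible_iff cmp_closed[of n i A B]
  by (simp add: composable_iff folding_eq vert_invertible_iff)

lemma T_invertible_cmp_next:
  assumes "T_invertible C n i A" "T_invertible C n i B" "composable C n (i + 1) A B"
  shows "T_invertible C n i (cmp C n (i + 1) A B)"
  using assms invertible_folding_hc[of A B] T_invertible_iff cmp_closed[of n "i + 1" A B]
  by (simp add: composable_iff folding_eq vert_invertible_iff)

lemma T_invertible_if_R:
  assumes "R_invertible C n i A"
  shows "T_invertible C n i A"
  using assms invertible_folding[of A] vert.invertible_closed[of A]
  by (simp add: T_invertible_iff folding_eq vert_invertible_iff)

lemma T_invertible_thin:
  assumes "f \<in> cells C (n - 1)"
  shows "T_invertible C n i (degen C (n - 1) i f)" "T_invertible C n i (degen C (n - 1) (i + 1) f)"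
    "T_invertible C n i (conn C (n - 1) i \<alpha> f)"
  using assms e1_invertible[of f]
  by (cases \<alpha>; simp add: T_invertible_iff vert_invertible_iff flip: folding_eq)+

text \<open>North and south are the faces in direction \<open>i\<close>; their invertibility is what
  \<open>horiz_invertible_if_folding\<close> asks for on the way back from the folding.\<close>

lemma R_invertible_psi_iff:
  assumes "A \<in> cells C n" "\<And>\<alpha>. R_invertible C (n - 1) i (face C n i \<alpha> A)"
  shows "R_invertible C n (i + 1) A \<longleftrightarrow> R_invertible C n i (psi C n i A)"
  using assms invertible_folding_if_horiz[of A] horiz_invertible_if_folding[of A]
  by (auto simp: horiz_invertible_iff vert_invertible_iff edge_invertible_iff folding_eq)

end

context cubical_omega
begin

lemma planeI: "\<lbrakk>1 \<le> i; i < n\<rbrakk> \<Longrightarrow> cubical_plane C n i"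
  by unfold_locales auto

section \<open>Commutation of psi_i with operations in other directions\<close>

lemma face_psi:
  assumes "A \<in> cells C n" "1 \<le> i" "i < n" "1 \<le> m" "m \<le> n" "m \<noteq> i" "m \<noteq> i + 1"
  shows "face C n m \<alpha> (psi C n i A) = psi C (n - 1) (down m i) (face C n m \<alpha> A)"
proof -
  interpret cubical_plane C n i by (rule planeI) fact+
  have d: "down m (i + 1) = down m i + 1" "down (i + 1) m = down i m"
    using assms by (auto simp: down_def)
  have n: "n - 1 + 1 = n" "n - 1 - 1 = n - 2" using assms by auto
  have "face C (n - 1) (down i m) \<alpha> (face C n (i + 1) \<beta> A) =
      face C (n - 1) (down m i + 1) \<beta> (face C n m \<alpha> A)" for \<beta>
    using face_face_general[of A n "i + 1" m \<alpha> \<beta>] assms by (simp add: d)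
  then have "face C n m \<alpha> (conn C (n - 1) i \<gamma> (face C n (i + 1) \<beta> A)) =
     conn C (n - 2) (down m i) \<gamma> (face C (n - 1) (down m i + 1) \<beta> (face C n m \<alpha> A))" for \<beta> \<gamma>
    using face_conn[of "n - 1" m i "face C n (i + 1) \<beta> A" \<alpha> \<gamma>] assms n by (simp add: face_closed)
  then show ?thesis
    using psi_composable[OF assms(1)] assms by (simp add: psi_def face_cmp d n)
qed

text \<open>With k > i + 1, Gamma_k lies beyond both directions used by psi_i: it moves past the
  connections Gamma_i by \<open>conn_conn\<close>, and on the (i+1)-faces its index drops to k -
  1.\<close>

lemma conn_psi:
  assumes "A \<in> cells C n" "1 \<le> i" "i + 1 < k" "k \<le> n"
  shows "conn C n k \<gamma> (psi C n i A) = psi C (n + 1) i (conn C n k \<gamma> A)"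
proof -
  interpret cubical_plane C n i using assms by (intro planeI) auto
  have n: "n - 1 + 1 = n" "n - 1 + 2 = n + 1" "k - 1 + 1 = k" using assms by auto
  have "face C (n + 1) (i + 1) \<beta> (conn C n k \<gamma> A) = conn C (n - 1) (k - 1) \<gamma> (face C n (i + 1) \<beta> A)" for \<beta>
    using face_conn[of n "i + 1" k A \<beta> \<gamma>] assms by (simp add: down_def)
  moreover have "conn C n k \<gamma> (conn C (n - 1) i \<delta> (face C n (i + 1) \<beta> A)) =
      conn C n i \<delta> (conn C (n - 1) (k - 1) \<gamma> (face C n (i + 1) \<beta> A))" for \<beta> \<delta>
    using conn_conn[of "n - 1" i "k - 1" "face C n (i + 1) \<beta> A" \<delta> \<gamma>] assms n by (simp add: face_closed)
  moreover have "up k (i + 1) = i + 1" using assms by (simp add: up_def)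
  ultimately show ?thesis
    using psi_composable[OF assms(1)] assms by (simp add: psi_def conn_cmp)
qed

lemma degen_psi:
  assumes "A \<in> cells C n" "1 \<le> i" "i < n" "i + 1 < k" "k \<le> n + 1"
  shows "degen C n k (psi C n i A) = psi C (n + 1) i (degen C n k A)"
proof -
  interpret cubical_plane C n i using assms by (intro planeI) auto
  have n: "n - 1 + 1 = n" "n - 1 + 2 = n + 1" "k - 1 + 1 = k" using assms by auto
  have "face C (n + 1) (i + 1) \<beta> (degen C n k A) = degen C (n - 1) (k - 1) (face C n (i + 1) \<beta> A)" for \<beta>
    using face_degen[of n "i + 1" k A \<beta>] assms by (simp add: down_def)
  moreover have "degen C n k (conn C (n - 1) i \<delta> (face C n (i + 1) \<beta> A)) =
      conn C n i \<delta> (degen C (n - 1) (k - 1) (face C n (i + 1) \<beta> A))" for \<beta> \<delta>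
    using conn_degen[of "n - 1" i "k - 1" "face C n (i + 1) \<beta> A" \<delta>] assms n
    by (simp add: face_closed up_def down_def)
  moreover have "up k (i + 1) = i + 1" using assms by (simp add: up_def)
  ultimately show ?thesis
    using psi_composable[OF assms(1)] assms by (simp add: psi_def degen_cmp)
qed

lemma psi_cmp:
  assumes "composable C n k A B" "1 \<le> i" "i + 1 < k"
  shows "psi C n i (cmp C n k A B) = cmp C n k (psi C n i A) (psi C n i B)"
    "composable C n k (psi C n i A) (psi C n i B)"
proof -
  have k: "k \<le> n" and AB: "A \<in> cells C n" "B \<in> cells C n" and fk: "face C n k Plus A = face C n k Minus B"
    using assms by (auto simp: composable_iff)
  interpret cubical_plane C n i using assms k by (intro planeI) auto
  have n: "n - 1 + 1 = n" using k assms by auto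
  have d: "down (i + 1) k = k - 1" "up i (k - 1) = k" "down k (i + 1) = i + 1" "1 \<le> k - 1"
    using assms by (auto simp: down_def up_def)
  have f: "face C n (i + 1) \<beta> (cmp C n k A B) = cmp C (n - 1) (k - 1) (face C n (i + 1) \<beta> A) (face C n (i + 1) \<beta> B)" for \<beta>
    using face_cmp[of n "i + 1" k A B \<beta>] assms k by (simp add: d)
  have cf: "composable C (n - 1) (k - 1) (face C n (i + 1) \<beta> A) (face C n (i + 1) \<beta> B)" for \<beta>
    using face_face_general[of A n "i + 1" k Plus \<beta>] face_face_general[of B n "i + 1" k Minus \<beta>]
      AB assms k d fk diff_le_mono[OF k, of 1] by (simp add: composable_iff face_closed)
  have g: "conn C (n - 1) i \<gamma> (cmp C (n - 1) (k - 1) (face C n (i + 1) \<beta> A) (face C n (i + 1) \<beta> B)) =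
     cmp C n k (conn C (n - 1) i \<gamma> (face C n (i + 1) \<beta> A)) (conn C (n - 1) i \<gamma> (face C n (i + 1) \<beta> B))" for \<beta> \<gamma>
    using conn_cmp[of "n - 1" i "k - 1", OF _ _ _ _ cf] assms k by (simp add: d n)
  have fc: "face C n k \<delta> (conn C (n - 1) i \<gamma> x) = conn C (n - 2) i \<gamma> (face C (n - 1) (k - 1) \<delta> x)"
    if "x \<in> cells C (n - 1)" for x \<gamma> \<delta>
    using face_conn[of "n - 1" k i x \<delta> \<gamma>] that assms k n by (simp add: down_def)
  have cg: "composable C n k (conn C (n - 1) i \<gamma> (face C n (i + 1) \<beta> A)) (conn C (n - 1) i \<gamma> (face C n (i + 1) \<beta> B))" for \<beta> \<gamma>
    using cf[of \<beta>] conn_closed[of "n - 1" i _ \<gamma>] assms k n by (simp add: composable_iff fc)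
  have c: "composable C n k (cmp C n (i + 1) (conn C (n - 1) i Plus (face C n (i + 1) Minus A)) A)
      (cmp C n (i + 1) (conn C (n - 1) i Plus (face C n (i + 1) Minus B)) B)"
    using psi_composable[OF AB(1)] psi_composable[OF AB(2)] cg[of Plus Minus] fk assms k
    by (simp add: composable_iff cmp_closed face_cmp d)
  show 1: "psi C n i (cmp C n k A B) = cmp C n k (psi C n i A) (psi C n i B)"
    unfolding psi_def f g
    using psi_composable[OF AB(1)] psi_composable[OF AB(2)] cg c assms
    by (simp add: cmp_interchange[of n k "i + 1"])
  show "composable C n k (psi C n i A) (psi C n i B)"
    using face_psi[of A n i k Plus] face_psi[of B n i k Minus] AB fk assms k psi_cell
    by (simp add: composable_iff)
qed

subsection \<open>Stability of T-invertibility\<close>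

lemma T_invertible_iff_R:
  "\<lbrakk>A \<in> cells C n; 1 \<le> i; i < n\<rbrakk> \<Longrightarrow> T_invertible C n i A \<longleftrightarrow> R_invertible C n i (psi C n i A)"
  using cubical_plane.T_invertible_iff[OF planeI] by blast

lemma psi_closed:
  "\<lbrakk>A \<in> cells C n; 1 \<le> i; i < n\<rbrakk> \<Longrightarrow> psi C n i A \<in> cells C n"
  using cubical_plane.psi_cell[OF planeI] by blast

lemma T_invertible_cell: "T_invertible C n i A \<Longrightarrow> A \<in> cells C n"
  by (auto simp: T_invertible_def is_T_inverse_def)

lemma T_invertible_if_R_invertible:
  "\<lbrakk>R_invertible C n i A; 1 \<le> i; i < n\<rbrakk> \<Longrightarrow> T_invertible C n i A"
  using cubical_plane.T_invertible_if_R[OF planeI] by blast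

lemma T_invertible_degen_thin:
  "\<lbrakk>f \<in> cells C (n - 1); 1 \<le> i; i < n; k = i \<or> k = i + 1\<rbrakk> \<Longrightarrow> T_invertible C n i (degen C (n - 1) k f)"
  using cubical_plane.T_invertible_thin(1,2)[OF planeI] by blast

lemma T_invertible_conn_thin:
  "\<lbrakk>f \<in> cells C (n - 1); 1 \<le> i; i < n\<rbrakk> \<Longrightarrow> T_invertible C n i (conn C (n - 1) i \<alpha> f)"
  using cubical_plane.T_invertible_thin(3)[OF planeI] by blast

text \<open>In directions i and i + 1 the folding of a composite is a composite of whiskered
  foldings. In later directions psi_i respects composition, and R_i-invertibility passes to
  composites in every direction.\<close>

lemma T_invertible_cmp:
  assumes "T_invertible C n i A" "T_invertible C n i B" "composable C n k A B" "1 \<le> i" "i < n" "i \<le> k"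
  shows "T_invertible C n i (cmp C n k A B)"
proof -
  consider "k = i" | "k = i + 1" | "i + 1 < k" using assms by linarith
  then show ?thesis
  proof cases
    case 1
    then show ?thesis using cubical_plane.T_invertible_cmp_i[OF planeI] assms by blast
  next
    case 2
    then show ?thesis using cubical_plane.T_invertible_cmp_next[OF planeI] assms by blast
  next
    case 3
    have "A \<in> cells C n" "B \<in> cells C n" using assms by (auto simp: composable_iff)
    then show ?thesis
      using assms psi_cmp[OF assms(3) assms(4) 3]
      by (simp add: T_invertible_iff_R cmp_closed R_invertible_cmp)
  qed
qed

lemma T_invertible_face:
  assumes "T_invertible C n i A" "1 \<le> i" "i < n" "1 \<le> m" "m \<le> n" "m \<noteq> i" "m \<noteq> i + 1"
  shows "T_invertible C (n - 1) (down m i) (face C n m \<alpha> A)"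
proof -
  have "A \<in> cells C n" using assms(1) by (rule T_invertible_cell)
  moreover have "1 \<le> down m i" "down m i < n - 1" using assms by (auto simp: down_def)
  ultimately show ?thesis
    using assms R_invertible_face[of n i "psi C n i A" m \<alpha>]
    by (simp add: T_invertible_iff_R face_closed face_psi)
qed

lemma T_invertible_conn_far:
  assumes "T_invertible C n i A" "1 \<le> i" "i + 1 < k" "k \<le> n"
  shows "T_invertible C (n + 1) i (conn C n k \<alpha> A)"
proof -
  have "A \<in> cells C n" using assms(1) by (rule T_invertible_cell)
  moreover have "up k i = i" using assms by (simp add: up_def)
  ultimately show ?thesis
    using assms R_invertible_conn[of n i "psi C n i A" k \<alpha>] conn_closed[of n k A \<alpha>]
    by (simp add: T_invertible_iff_R conn_psi)
qed

lemma T_invertible_degen_far: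
  assumes "T_invertible C n i A" "1 \<le> i" "i < n" "i + 1 < k" "k \<le> n + 1"
  shows "T_invertible C (n + 1) i (degen C n k A)"
proof -
  have "A \<in> cells C n" using assms(1) by (rule T_invertible_cell)
  moreover have "up k i = i" using assms by (simp add: up_def)
  ultimately show ?thesis
    using assms R_invertible_degen_any[of n i "psi C n i A" k] degen_closed[of n k A]
    by (simp add: T_invertible_iff_R degen_psi)
qed

text \<open>The two properties are bundled so as to be stable under composition: by the transport
  laws, Gamma_{i+1} of a composite in direction i + 1 contains not only Gamma_{i+1} of the factors
  but also eps_{i+2} of a factor, which is T_i-invertible when that factor is.\<close>

definition conn_T_invertible :: "nat \<Rightarrow> nat \<Rightarrow> sign \<Rightarrow> 'a \<Rightarrow> bool" where
  "conn_T_invertible n i \<alpha> A \<longleftrightarrow>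
     T_invertible C n i A \<and> T_invertible C (n + 1) i (conn C n (i + 1) \<alpha> A)"

lemma conn_T_invertible_cmp_i:
  assumes "conn_T_invertible n i \<alpha> A" "conn_T_invertible n i \<alpha> B" "composable C n i A B" "1 \<le> i" "i < n"
  shows "conn_T_invertible n i \<alpha> (cmp C n i A B)"
proof -
  have AB: "A \<in> cells C n" "B \<in> cells C n" using assms by (auto simp: composable_iff)
  have d: "up (i + 1) i = i" "down i (i + 1) = i" "down (i + 1) i = i" by (auto simp: up_def down_def)
  have c: "composable C (n + 1) i (conn C n (i + 1) \<alpha> A) (conn C n (i + 1) \<alpha> B)"
    using AB assms conn_closed[of n "i + 1" A \<alpha>] conn_closed[of n "i + 1" B \<alpha>]
      face_conn[of n i "i + 1" A Plus \<alpha>] face_conn[of n i "i + 1" B Minus \<alpha>]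
    by (simp add: composable_iff d)
  have "conn C n (i + 1) \<alpha> (cmp C n i A B) = cmp C (n + 1) i (conn C n (i + 1) \<alpha> A) (conn C n (i + 1) \<alpha> B)"
    using conn_cmp[of n "i + 1" i A B \<alpha>] assms by (simp add: d)
  then show ?thesis
    using assms c by (simp add: conn_T_invertible_def T_invertible_cmp)
qed

lemma conn_T_invertible_cmp_next:
  assumes "conn_T_invertible n i \<alpha> A" "conn_T_invertible n i \<alpha> B" "composable C n (i + 1) A B" "1 \<le> i" "i < n"
  shows "conn_T_invertible n i \<alpha> (cmp C n (i + 1) A B)"
proof -
  interpret Q: cubical_plane C "n + 1" "i + 1"
    rewrites "n + 1 - 1 = n" and "n + 1 - 2 = n - 1"
    using assms by (auto intro!: planeI)
  have AB: "A \<in> cells C n" "B \<in> cells C n" "face C n (i + 1) Plus A = face C n (i + 1) Minus B"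
    using assms by (auto simp: composable_iff)
  have T: "T_invertible C n i A" "T_invertible C n i B"
    "T_invertible C (n + 1) i (conn C n (i + 1) \<alpha> A)" "T_invertible C (n + 1) i (conn C n (i + 1) \<alpha> B)"
    using assms by (auto simp: conn_T_invertible_def)
  have thin: "T_invertible C (n + 1) i (degen C n (i + 1) D)" if "D \<in> cells C n" for D
    using that T_invertible_degen_thin[of D "n + 1" i "i + 1"] assms by simp
  have far: "T_invertible C (n + 1) i (degen C n (i + 1 + 1) D)" if "T_invertible C n i D" for D
    using that T_invertible_degen_far[of n i D "i + 1 + 1"] assms by simp
  have "T_invertible C (n + 1) i (conn C n (i + 1) \<alpha> (cmp C n (i + 1) A B))"
  proof (cases \<alpha>)
    case Plus
    show ?thesis
      using Q.gp_ec[of A B] AB T[unfolded Plus] thin far assms(4,5)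
      unfolding Plus
      by (auto intro!: T_invertible_cmp simp: composable_iff)
  next
    case Minus
    show ?thesis
      using Q.gm_ec[of A B] AB T[unfolded Minus] thin far assms(4,5)
      unfolding Minus
      by (auto intro!: T_invertible_cmp simp: composable_iff)
  qed
  then show ?thesis using T assms by (simp add: conn_T_invertible_def T_invertible_cmp)
qed

lemma conn_T_invertible_degen:
  assumes "f \<in> cells C (n - 1)" "1 \<le> i" "i < n"
  shows "conn_T_invertible n i \<alpha> (degen C (n - 1) i f)"
proof -
  have n: "n - 1 + 1 = n" "n - 1 + 2 = n + 1" using assms by auto
  have "conn C n (i + 1) \<alpha> (degen C (n - 1) i f) = degen C n i (conn C (n - 1) i \<alpha> f)"
    using conn_degen[of "n - 1" "i + 1" i f \<alpha>] assms n by (simp add: up_def down_def)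
  moreover have "conn C (n - 1) i \<alpha> f \<in> cells C n"
    using conn_closed[of "n - 1" i f \<alpha>] assms n by simp
  ultimately show ?thesis
    using T_invertible_degen_thin[of f n i i] T_invertible_degen_thin[of "conn C (n - 1) i \<alpha> f" "n + 1" i i] assms
    by (simp add: conn_T_invertible_def)
qed

text \<open>For opposite signs no axiom rewrites $\Gamma_{i+1}^\alpha\Gamma_i^\beta$; instead, its image
  under $\psi_i$ contains both connections $\Gamma_{i+1}^\pm$ of the same cell, which cancel.\<close>

lemma conn_T_invertible_conn:
  assumes f: "f \<in> cells C (n - 1)" and i: "1 \<le> i" "i < n"
  shows "conn_T_invertible n i \<alpha> (conn C (n - 1) i \<beta> f)"
proof -
  have n: "n - 1 + 1 = n" "n - 1 + 2 = n + 1" using i by auto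
  have i': "i < n + 1" "i \<le> n + 1" using i by auto
  interpret P: cubical_plane C n i using i by (rule planeI)
  interpret Q: cubical_plane C "n + 1" "i + 1"
    rewrites "n + 1 - 1 = n" and "n + 1 - 2 = n - 1"
    using i by (auto intro!: planeI)
  have y: "conn C (n - 1) i \<gamma> f \<in> cells C n" for \<gamma>
    using conn_closed[of "n - 1" i f] f i n by simp
  have same: "conn C n (i + 1) \<gamma> (conn C (n - 1) i \<gamma> f) = conn C n i \<gamma> (conn C (n - 1) i \<gamma> f)" for \<gamma>
    using conn_conn_same[of "n - 1" i f \<gamma>] f i n by simp
  have far: "conn C n i \<gamma> (degen C (n - 1) (i + 1) f) = degen C n (i + 1 + 1) (conn C (n - 1) i \<gamma> f)" for \<gamma>
    using conn_degen[of "n - 1" i "i + 1" f \<gamma>] f i n by (simp add: up_def down_def)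
  have ef: "degen C (n - 1) (i + 1) f \<in> cells C n"
    using degen_closed[of "n - 1" "i + 1" f] f i n by simp
  have "T_invertible C (n + 1) i (conn C n (i + 1) \<alpha> (conn C (n - 1) i \<beta> f))"
  proof (cases "\<alpha> = \<beta>")
    case True
    then show ?thesis
      using T_invertible_conn_thin[of "conn C (n - 1) i \<beta> f" "n + 1" i] y i by (simp add: same)
  next
    case False
    let ?Y = "conn C n (i + 1) \<alpha> (conn C (n - 1) i \<beta> f)"
    have "degen C n (i + 1 + 1) (cmp C n (i + 1) (conn C (n - 1) i Plus f) (conn C (n - 1) i Minus f))
      = degen C n i (degen C (n - 1) (i + 1) f)"
      using degen_degen[of "n - 1" i "i + 1" f] f i n by simp
    then have ee: "cmp C (n + 1) (i + 1) (degen C n (i + 1 + 1) (conn C (n - 1) i Plus f))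
         (degen C n (i + 1 + 1) (conn C (n - 1) i Minus f)) = degen C n i (degen C (n - 1) (i + 1) f)"
      using Q.e2_ec[of "conn C (n - 1) i Plus f" "conn C (n - 1) i Minus f"] y f by simp
    \<comment> \<open>By \<open>same\<close>, one outer factor of psi_i is the connection
      Gamma_{i+1} of the same cell with the other sign; together with \<open>?Y\<close> it gives
      eps_{i+2} of that cell. By \<open>far\<close>, the other outer factor is eps_{i+2} of the
      other connection of \<open>f\<close>. Their composite is eps_{i+2} eps_i f by
      \<open>ee\<close>, hence degenerate in direction i.\<close>
    have "psi C (n + 1) i ?Y = degen C n i (degen C (n - 1) (i + 1) f)"
    proof (cases \<alpha>)
      case Plus
      then have \<beta>: "\<beta> = Minus" using False by (cases \<beta>) auto
      show ?thesis
        using y[of Plus] y[of Minus] f Q.vert.assoc Q.gp_vc_gm[of "conn C (n - 1) i Minus f"] ee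
        unfolding psi_def Plus \<beta>
        by (simp add: far flip: same)
    next
      case Minus
      then have \<beta>: "\<beta> = Plus" using False by (cases \<beta>) auto
      show ?thesis
        using y[of Plus] y[of Minus] f Q.gp_vc_gm[of "conn C (n - 1) i Plus f"] ee
        unfolding psi_def Minus \<beta>
        by (simp add: far flip: same)
    qed
    moreover have "?Y \<in> cells C (n + 1)" using conn_closed[of n "i + 1"] y i by simp
    ultimately show ?thesis
      using R_invertible_degen[of i n] T_invertible_iff_R[of ?Y "n + 1" i] ef i i' by simp
  qed
  then show ?thesis using T_invertible_conn_thin f i by (simp add: conn_T_invertible_def)
qed

lemma conn_T_invertible_if_R:
  assumes "R_invertible C n i A" "1 \<le> i" "i < n"
  shows "conn_T_invertible n i \<alpha> A"
proof -
  have "up (i + 1) i = i" by (simp add: up_def)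
  then have "R_invertible C (n + 1) i (conn C n (i + 1) \<alpha> A)"
    using R_invertible_conn[of n i A "i + 1" \<alpha>] assms by simp
  then show ?thesis using assms by (simp add: conn_T_invertible_def T_invertible_if_R_invertible)
qed

text \<open>By \<open>unfold_folding\<close>, A is a composite in directions i and i + 1 of psi_i A
  with degeneracies eps_i and connections Gamma_i of its faces. Each piece satisfies
  \<open>conn_T_invertible\<close>: psi_i A because it is R_i-invertible, the others by direct
  computation.\<close>

lemma T_invertible_conn_next:
  assumes "T_invertible C n i A" "1 \<le> i" "i < n"
  shows "T_invertible C (n + 1) i (conn C n (i + 1) \<alpha> A)"
proof -
  interpret P: cubical_plane C n i using assms by (intro planeI)
  have A: "A \<in> cells C n" using assms T_invertible_cell by blast
  have "conn_T_invertible n i \<alpha> (psi C n i A)"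
    using assms A conn_T_invertible_if_R by (simp add: T_invertible_iff_R)
  then have "conn_T_invertible n i \<alpha> (P.unfold (face C n i Minus A) (face C n (i + 1) Minus A)
       (face C n (i + 1) Plus A) (face C n i Plus A) (P.folding A))"
    unfolding P.unfold_def using A assms(2,3)
    by (intro conn_T_invertible_cmp_i conn_T_invertible_cmp_next conn_T_invertible_degen conn_T_invertible_conn)
      (simp_all add: composable_iff flip: P.folding_eq)
  then show ?thesis using A by (simp add: P.unfold_folding conn_T_invertible_def)
qed

subsection \<open>Iterated foldings\<close>

lemma T_invertible_conn_greater:
  assumes "T_invertible C (n - 1) i A" "1 \<le> i" "i < k" "k < n"
  shows "T_invertible C n i (conn C (n - 1) k \<alpha> A)"
proof (cases "k = i + 1")
  case True
  then show ?thesis using T_invertible_conn_next[of "n - 1" i A \<alpha>] assms by simp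
next
  case False
  then show ?thesis using T_invertible_conn_far[of "n - 1" i A k \<alpha>] assms by simp
qed

text \<open>For k = i + 1 the cell is thin in the plane of directions i and i + 1; for larger k the
  T_i-invertibility of \<open>A\<close> is carried over.\<close>

lemma T_invertible_degen_greater:
  assumes "A \<in> cells C (n - 1)" "i + 1 < k \<Longrightarrow> T_invertible C (n - 1) i A" "1 \<le> i" "i < k" "k \<le> n"
  shows "T_invertible C n i (degen C (n - 1) k A)"
proof (cases "k = i + 1")
  case True
  then show ?thesis using T_invertible_degen_thin[of A n i k] assms by simp
next
  case False
  then have "i + 1 < k" "i < n - 1" "n - 1 + 1 = n" using assms by auto
  then show ?thesis using T_invertible_degen_far[of "n - 1" i A k] assms by simp
qed

lemma T_invertible_psi:
  assumes "T_invertible C n i A" "1 \<le> i" "i < k" "k < n"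
  shows "T_invertible C n i (psi C n k A)"
proof -
  have A: "A \<in> cells C n" using assms T_invertible_cell by blast
  have "composable C n (k + 1) (conn C (n - 1) k Plus (face C n (k + 1) Minus A)) A"
    "composable C n (k + 1) (cmp C n (k + 1) (conn C (n - 1) k Plus (face C n (k + 1) Minus A)) A)
      (conn C (n - 1) k Minus (face C n (k + 1) Plus A))"
    using cubical_plane.psi_composable[OF planeI A] assms by simp_all
  moreover have "T_invertible C (n - 1) i (face C n (k + 1) \<alpha> A)" for \<alpha>
    using T_invertible_face[of n i A "k + 1" \<alpha>] assms by (simp add: down_def)
  ultimately show ?thesis
    unfolding psi_def using assms by (intro T_invertible_cmp T_invertible_conn_greater) auto
qed

text \<open>For the converse, \<open>A\<close> is unfolded from psi_k A using Gamma_k of its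
  (k+1)-faces and eps_k of its k-faces. When k = i + 1 the latter are thin, so the k-faces enter
  only for larger k.\<close>

lemma T_invertible_psi_iff:
  assumes A: "A \<in> cells C n" and k: "1 \<le> i" "i < k" "k < n"
    and next_faces: "\<And>\<alpha>. T_invertible C (n - 1) i (face C n (k + 1) \<alpha> A)"
    and k_faces: "\<And>\<alpha>. i + 1 < k \<Longrightarrow> T_invertible C (n - 1) i (face C n k \<alpha> A)"
  shows "T_invertible C n i (psi C n k A) \<longleftrightarrow> T_invertible C n i A"
proof
  assume psi: "T_invertible C n i (psi C n k A)"
  have in': "i < n" "i \<le> k" "i \<le> k + 1" "1 \<le> k" using k by auto
  interpret K: cubical_plane C n k using k by (intro planeI) auto
  have fk: "face C n k \<alpha> A \<in> cells C (n - 1)" for \<alpha>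
    using A by (cases \<alpha>) simp_all
  have "T_invertible C n i (K.unfold (face C n k Minus A) (face C n (k + 1) Minus A)
     (face C n (k + 1) Plus A) (face C n k Plus A) (K.folding A))"
    unfolding K.unfold_def
    by (intro T_invertible_cmp T_invertible_conn_greater T_invertible_degen_greater next_faces k_faces)
      (use A psi in' k(1,2) fk in \<open>simp_all add: composable_iff K.folding_eq[symmetric]\<close>)
  then show "T_invertible C n i A" using A by (simp add: K.unfold_folding)
qed (use k T_invertible_psi in blast)

text \<open>A face in direction i or i + 1 loses one of the two directions that T_i exchanges, so
  these are excluded; \<open>down m i\<close> is the position of direction i in the m-face.\<close>

definition T_faces :: "nat \<Rightarrow> nat \<Rightarrow> 'a \<Rightarrow> bool" where
  "T_faces n i A \<longleftrightarrow> A \<in> cells C n \<and>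
    (\<forall>m \<alpha>. 1 \<le> m \<longrightarrow> m \<le> n \<longrightarrow> m \<noteq> i \<longrightarrow> m \<noteq> i + 1 \<longrightarrow>
      T_invertible C (n - 1) (down m i) (face C n m \<alpha> A))"

definition R_faces :: "nat \<Rightarrow> nat \<Rightarrow> 'a \<Rightarrow> bool" where
  "R_faces n i A \<longleftrightarrow> A \<in> cells C n \<and>
    (\<forall>m \<alpha>. 1 \<le> m \<longrightarrow> m \<le> n \<longrightarrow> m \<noteq> i \<longrightarrow>
      R_invertible C (n - 1) (down m i) (face C n m \<alpha> A))"

lemma face_psi_next_eq:
  assumes "A \<in> cells C n" "1 \<le> k" "k < n"
  shows "\<exists>\<beta>. face C n (k + 1) \<alpha> (psi C n k A) = degen C (n - 2) k (face C (n - 1) k \<alpha> (face C n (k + 1) \<beta> A))"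
proof -
  interpret K: cubical_plane C n k using assms by (intro planeI) auto
  show ?thesis
  proof (cases \<alpha>)
    case Minus
    then show ?thesis using assms by (intro exI[of _ Minus]) (simp add: K.face_psi_next_Minus)
  next
    case Plus
    then show ?thesis using assms by (intro exI[of _ Plus]) (simp add: K.face_psi_next_Plus)
  qed
qed

lemma T_faces_psi:
  assumes "T_faces n i A" "1 \<le> i" "i < k" "k < n"
  shows "T_faces n i (psi C n k A)"
  unfolding T_faces_def
proof (intro conjI allI impI)
  have A: "A \<in> cells C n"
    and T: "\<And>m \<alpha>. 1 \<le> m \<Longrightarrow> m \<le> n \<Longrightarrow> m \<noteq> i \<Longrightarrow> m \<noteq> i + 1 \<Longrightarrow>
      T_invertible C (n - 1) (down m i) (face C n m \<alpha> A)"
    using assms by (auto simp: T_faces_def)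
  show "psi C n k A \<in> cells C n" using A assms psi_closed by simp
  fix m \<alpha>
  assume m: "1 \<le> m" "m \<le> n" "m \<noteq> i" "m \<noteq> i + 1"
  consider "m = k" | "m = k + 1" | "m \<noteq> k" "m \<noteq> k + 1" by blast
  then show "T_invertible C (n - 1) (down m i) (face C n m \<alpha> (psi C n k A))"
  proof cases
    case 1
    have k: "i + 1 < k" using m 1 assms by auto
    have d: "down k i = i" "down (k + 1) i = i" using assms by (auto simp: down_def)
    have Tk: "T_invertible C (n - 1) i (face C n k \<beta> A)" "T_invertible C (n - 1) i (face C n (k + 1) \<beta> A)" for \<beta>
      using T[of k \<beta>] T[of "k + 1" \<beta>] m 1 assms by (auto simp: d)
    have b: "i < n - 1" "i \<le> k" "k \<le> n - 1" "1 \<le> k" using assms by auto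
    interpret K: cubical_plane C n k using assms by (intro planeI) auto
    show ?thesis
    proof (cases \<alpha>)
      case Minus
      then show ?thesis
        using T_invertible_cmp[of "n - 1" i, OF Tk(1)[of Minus] Tk(2)[of Plus], of k] A b assms
        by (simp add: 1 d K.face_psi_i_Minus composable_iff)
    next
      case Plus
      then show ?thesis
        using T_invertible_cmp[of "n - 1" i, OF Tk(2)[of Minus] Tk(1)[of Plus], of k] A b assms
        by (simp add: 1 d K.face_psi_i_Plus composable_iff)
    qed
  next
    case 2
    have d: "down m i = i" using assms 2 by (auto simp: down_def)
    obtain \<beta> where \<beta>: "face C n m \<alpha> (psi C n k A) = degen C (n - 2) k (face C (n - 1) k \<alpha> (face C n m \<beta> A))"
      using face_psi_next_eq[OF A, of k \<alpha>] assms 2 by auto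
    have f: "face C n m \<beta> A \<in> cells C (n - 1)" "face C (n - 1) k \<alpha> (face C n m \<beta> A) \<in> cells C (n - 2)"
      using face_closed[of n m A \<beta>] face_closed[of "n - 1" k "face C n m \<beta> A" \<alpha>] A m assms
      by (auto simp: numeral_2_eq_2)
    \<comment> \<open>If k = i + 1 this degeneracy is thin. Otherwise it degenerates a k-face of an
      m-face of \<open>A\<close>, and T_i-invertibility passes from the m-face to that
      corner.\<close>
    have "T_invertible C (n - 1) i (degen C (n - 2) k (face C (n - 1) k \<alpha> (face C n m \<beta> A)))"
      using T_invertible_degen_greater[of _ "n - 1" i k] f assms
        T_invertible_face[of "n - 1" i "face C n m \<beta> A" k \<alpha>] T[of m \<beta>] m d
      by (simp add: diff_diff_eq) (simp add: down_def)
    then show ?thesis by (simp add: d \<beta>)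
  next
    case 3
    have "T_invertible C (n - 1) (down m i) (psi C (n - 1) (down m k) (face C n m \<alpha> A))"
      using m 3 assms by (intro T_invertible_psi T) (auto simp: down_def)
    then show ?thesis using face_psi[of A n k m \<alpha>] A m 3 assms by simp
  qed
qed

lemma R_invertible_face_psi_next:
  assumes "A \<in> cells C n" "1 \<le> k" "k < n"
  shows "R_invertible C (n - 1) k (face C n (k + 1) \<alpha> (psi C n k A))"
proof -
  obtain \<beta> where \<beta>: "face C n (k + 1) \<alpha> (psi C n k A) = degen C (n - 2) k (face C (n - 1) k \<alpha> (face C n (k + 1) \<beta> A))"
    using face_psi_next_eq[OF assms] by blast
  have "face C (n - 1) k \<alpha> (face C n (k + 1) \<beta> A) \<in> cells C (n - 2)"
    using face_closed[of n "k + 1" A \<beta>] face_closed[of "n - 1" k "face C n (k + 1) \<beta> A" \<alpha>] assms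
    by (auto simp: numeral_2_eq_2)
  moreover have "n - 2 + 1 = n - 1" using assms by auto
  ultimately show ?thesis
    using R_invertible_degen[of k "n - 2" "face C (n - 1) k \<alpha> (face C n (k + 1) \<beta> A)"] assms \<beta> by simp
qed

text \<open>The point where conditions on T_i become conditions on direction i: psi_i commutes with
  the faces away from i and i + 1 and turns their T-invertibility into R-invertibility, while the
  (i+1)-faces of psi_i A are degenerate in direction i.\<close>

lemma T_faces_R_faces:
  assumes "T_faces n i A" "1 \<le> i" "i < n"
  shows "R_faces n i (psi C n i A)"
  unfolding R_faces_def
proof (intro conjI allI impI)
  have A: "A \<in> cells C n"
    and T: "\<And>m \<alpha>. 1 \<le> m \<Longrightarrow> m \<le> n \<Longrightarrow> m \<noteq> i \<Longrightarrow> m \<noteq> i + 1 \<Longrightarrow>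
      T_invertible C (n - 1) (down m i) (face C n m \<alpha> A)"
    using assms by (auto simp: T_faces_def)
  show "psi C n i A \<in> cells C n" using A assms psi_closed by simp
  fix m \<alpha>
  assume m: "1 \<le> m" "m \<le> n" "m \<noteq> i"
  show "R_invertible C (n - 1) (down m i) (face C n m \<alpha> (psi C n i A))"
  proof (cases "m = i + 1")
    case True
    then show ?thesis using R_invertible_face_psi_next A assms by (simp add: down_def)
  next
    case False
    then have "1 \<le> down m i" "down m i < n - 1" using m assms by (auto simp: down_def)
    then show ?thesis
      using T[of m \<alpha>] A m False assms by (simp add: face_psi T_invertible_iff_R face_closed)
  qed
qed

lemma R_invertible_psi_iff:
  assumes "A \<in> cells C n" "1 \<le> k" "k < n" "\<And>\<alpha>. R_invertible C (n - 1) k (face C n k \<alpha> A)"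
  shows "R_invertible C n k (psi C n k A) \<longleftrightarrow> R_invertible C n (k + 1) A"
  using cubical_plane.R_invertible_psi_iff[OF planeI] assms by blast

lemma R_invertible_psi:
  assumes "R_invertible C n (k + 1) A" "1 \<le> k" "k < n"
  shows "R_invertible C n k (psi C n k A)"
proof -
  have "A \<in> cells C n" using assms by (auto simp: R_invertible_def R_inverses_def composable_iff)
  moreover have "R_invertible C (n - 1) k (face C n k \<alpha> A)" for \<alpha>
    using R_invertible_face[of n "k + 1" A k \<alpha>] assms by (simp add: down_def)
  ultimately show ?thesis using assms by (simp add: R_invertible_psi_iff)
qed

lemma R_faces_psi:
  assumes "R_faces n (k + 1) A" "1 \<le> k" "k < n"
  shows "R_faces n k (psi C n k A)"
  unfolding R_faces_def
proof (intro conjI allI impI)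
  have A: "A \<in> cells C n"
    and R: "\<And>m \<alpha>. 1 \<le> m \<Longrightarrow> m \<le> n \<Longrightarrow> m \<noteq> k + 1 \<Longrightarrow>
      R_invertible C (n - 1) (down m (k + 1)) (face C n m \<alpha> A)"
    using assms by (auto simp: R_faces_def)
  show "psi C n k A \<in> cells C n" using A assms psi_closed by simp
  fix m \<alpha>
  assume m: "1 \<le> m" "m \<le> n" "m \<noteq> k"
  show "R_invertible C (n - 1) (down m k) (face C n m \<alpha> (psi C n k A))"
  proof (cases "m = k + 1")
    case True
    then show ?thesis using R_invertible_face_psi_next A assms by (simp add: down_def)
  next
    case False
    then have "1 \<le> down m k" "down m k < n - 1" "down m (k + 1) = down m k + 1"
      using m assms by (auto simp: down_def)
    then show ?thesis
      using R[of m \<alpha>] A m False assms by (simp add: face_psi R_invertible_psi)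
  qed
qed

text \<open>\<open>foldr\<close> applies the last index first, so psi_k acts on \<open>A\<close> and
  moves the direction of invertibility from k + 1 to k; the next folding starts there, until
  direction 1 is reached.\<close>

lemma R_invertible_chain:
  "\<lbrakk>R_faces n (k + 1) A; k < n\<rbrakk>
    \<Longrightarrow> R_invertible C n 1 (foldr (psi C n) [1..<k + 1] A) \<longleftrightarrow> R_invertible C n (k + 1) A"
proof (induction k arbitrary: A)
  case (Suc k)
  have "R_invertible C (n - 1) (k + 1) (face C n (k + 1) \<alpha> A)" for \<alpha>
  proof -
    have "down (k + 1) (Suc k + 1) = k + 1" "1 \<le> k + 1" "k + 1 \<le> n" "k + 1 \<noteq> Suc k + 1"
      using Suc.prems by (auto simp: down_def)
    then show ?thesis using Suc.prems unfolding R_faces_def by metis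
  qed
  then have "R_invertible C n (k + 1) (psi C n (k + 1) A) \<longleftrightarrow> R_invertible C n (Suc k + 1) A"
    using R_invertible_psi_iff[of A n "k + 1"] Suc.prems by (simp add: R_faces_def Suc_eq_plus1)
  moreover have "R_faces n (k + 1) (psi C n (k + 1) A)"
    using R_faces_psi[of n "k + 1" A] Suc.prems by (simp add: Suc_eq_plus1)
  ultimately show ?case
    using Suc.IH[of "psi C n (k + 1) A"] Suc.prems by simp
qed simp

lemma T_invertible_chain:
  assumes "T_faces n i A" "1 \<le> i" "i < k" "k \<le> n"
  shows "T_faces n i (foldr (psi C n) [k..<n] A) \<and>
    (T_invertible C n i (foldr (psi C n) [k..<n] A) \<longleftrightarrow> T_invertible C n i A)"
  using assms(4,3)
\<comment> \<open>Downward induction from k = n, where the list is empty; each step adds the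
  outermost folding psi_k. \<open>T_faces\<close> is carried along to provide the face conditions of
  \<open>T_invertible_psi_iff\<close>.\<close>
proof (induction k rule: inc_induct)
  case base
  then show ?case using assms by simp
next
  case (step k)
  let ?A = "foldr (psi C n) [Suc k..<n] A"
  have T: "T_faces n i ?A" "T_invertible C n i ?A \<longleftrightarrow> T_invertible C n i A"
    using step by auto
  have d: "down (k + 1) i = i" "down k i = i" using step.prems by (auto simp: down_def)
  have "T_invertible C n i (psi C n k ?A) \<longleftrightarrow> T_invertible C n i ?A"
  proof (rule T_invertible_psi_iff)
    show "T_invertible C (n - 1) i (face C n (k + 1) \<alpha> ?A)" for \<alpha>
    proof -
      have "1 \<le> k + 1" "k + 1 \<le> n" "k + 1 \<noteq> i" "k + 1 \<noteq> i + 1" using step by auto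
      then show ?thesis using T(1) d(1) unfolding T_faces_def by metis
    qed
    show "T_invertible C (n - 1) i (face C n k \<alpha> ?A)" if "i + 1 < k" for \<alpha>
    proof -
      have "1 \<le> k" "k \<le> n" "k \<noteq> i" "k \<noteq> i + 1" using step assms(2) that by auto
      then show ?thesis using T(1) d(2) unfolding T_faces_def by metis
    qed
  qed (use T step assms in \<open>auto simp: T_faces_def\<close>)
  then show ?case
    using T T_faces_psi[OF T(1) assms(2) step.prems step.hyps(2)] step.hyps by (simp add: upt_conv_Cons)
qed

lemma T_invertible_iff_invertible_cell:
  assumes "T_faces n i A" "1 \<le> i" "i < n"
  shows "T_invertible C n i A \<longleftrightarrow> invertible_cell C n A"
proof -
  let ?B = "foldr (psi C n) [i + 1..<n] A"
  have B: "T_faces n i ?B" "T_invertible C n i ?B \<longleftrightarrow> T_invertible C n i A"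
    using T_invertible_chain[of n i A "i + 1"] assms by auto
  have "[1..<n] = [1..<i] @ i # [i + 1..<n]"
    using upt_add_eq_append[of 1 i "n - i"] upt_conv_Cons[of i n] assms
    by (metis Suc_eq_plus1 le_add_diff_inverse less_imp_le_nat)
  then have "foldr (psi C n) [1..<n] A = foldr (psi C n) [1..<i] (psi C n i ?B)"
    by simp
  moreover have "R_invertible C n 1 (foldr (psi C n) [1..<i] (psi C n i ?B)) \<longleftrightarrow>
      R_invertible C n i (psi C n i ?B)"
    using R_invertible_chain[of n "i - 1" "psi C n i ?B"] T_faces_R_faces[OF B(1) assms(2,3)] assms by simp
  ultimately show ?thesis
    using B assms by (simp add: invertible_cell_def R1_invertible_iff T_invertible_iff_R T_faces_def)
qed

end

subsection \<open>Shells\<close>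

lemma truncation_simps [simp]:
  "m \<le> k \<Longrightarrow> cells (truncation k C) m = cells C m"
  "face (truncation k C) = face C" "degen (truncation k C) = degen C"
  "conn (truncation k C) = conn C" "cmp (truncation k C) = cmp C"
  by (auto simp: truncation_def)

lemma shell_category_simps [simp]:
  "cells (shell_category k C) (k + 1) = Shell ` shells k C"
  "face (shell_category k C) = box_face C"
  "conn (shell_category k C) = box_conn k C" "cmp (shell_category k C) = box_cmp k C"
  by (auto simp: shell_category_def)

definition face_family :: "'a cubical_data \<Rightarrow> nat \<Rightarrow> 'a \<Rightarrow> 'a family" where
  "face_family C n A = (\<lambda>(i, \<alpha>) \<in> face_index n. face C n i \<alpha> A)"

lemma shell_of_eq: "shell_of C n A = Shell (face_family C n A)"
  by (simp add: shell_of_def face_family_def)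

text \<open>The equation in the top dimension of the shell category with the constructors of
  \<open>box_cell\<close> removed: the faces lie in dimension n, so their connections are
  families.\<close>

definition T_equation_shell :: "nat \<Rightarrow> 'a cubical_data \<Rightarrow> nat \<Rightarrow> 'a family \<Rightarrow> 'a family \<Rightarrow> bool" where
  "T_equation_shell n C i F G \<longleftrightarrow>
     cmp_shell n C (i + 1)
       (cmp_shell n C i (conn_shell n C i Plus (F (i + 1, Minus))) G)
       (cmp_shell n C i F (conn_shell n C i Minus (F (i, Plus))))
     = cmp_shell n C i (conn_shell n C i Minus (F (i, Minus))) (conn_shell n C i Plus (F (i + 1, Plus)))"

lemma T_equation_shell_category:
  "T_equation (shell_category n C) (n + 1) i (Shell F) (Shell G) \<longleftrightarrow> T_equation_shell n C i F G"
  by (simp add: T_equation_def T_equation_shell_def)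

lemma shell_face_face:
  assumes "F \<in> shells n C" "1 \<le> i" "i \<le> n + 1" "1 \<le> m" "m \<le> n + 1" "i \<noteq> m"
  shows "face C n (down m i) \<beta> (F (m, \<alpha>)) = face C n (down i m) \<alpha> (F (i, \<beta>))"
  using assms by (simp add: shells_def)

text \<open>Both families are evaluated at \<open>(m, \<alpha>)\<close>. Away from i and i + 1 the
  operations on shells act memberwise with shifted indices, and the compatibility of the shell turns
  faces of its i- and (i+1)-members into faces of its m-member.\<close>

lemma T_equation_face_if_shell:
  assumes eq: "T_equation_shell n C i F G" and F: "F \<in> shells n C"
    and i: "1 \<le> i" "i \<le> n" and m: "1 \<le> m" "m \<le> n + 1" "m \<noteq> i" "m \<noteq> i + 1"
  shows "T_equation C n (down m i) (F (m, \<alpha>)) (G (m, \<alpha>))"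
proof -
  have d: "down m (i + 1) = down m i + 1" "down (i + 1) m = down i m"
    using i m by (auto simp: down_def)
  have f: "face C n (down i m) \<alpha> (F (i + 1, \<beta>)) = face C n (down m i + 1) \<beta> (F (m, \<alpha>))"
    "face C n (down i m) \<alpha> (F (i, \<beta>)) = face C n (down m i) \<beta> (F (m, \<alpha>))" for \<beta>
    using shell_face_face[OF F, of "i + 1" m \<beta> \<alpha>] shell_face_face[OF F, of i m \<beta> \<alpha>] i m
    by (simp_all add: d)
  from eq have "cmp_shell n C (i + 1)
       (cmp_shell n C i (conn_shell n C i Plus (F (i + 1, Minus))) G)
       (cmp_shell n C i F (conn_shell n C i Minus (F (i, Plus)))) (m, \<alpha>)
     = cmp_shell n C i (conn_shell n C i Minus (F (i, Minus))) (conn_shell n C i Plus (F (i + 1, Plus))) (m, \<alpha>)"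
    unfolding T_equation_shell_def by (rule fun_cong)
  then show ?thesis
    using m by (simp add: T_equation_def cmp_shell_def conn_shell_def d f)
qed

lemma conn_shell_truncation [simp]: "conn_shell n (truncation k C) = conn_shell n C"
  and cmp_shell_truncation [simp]: "cmp_shell n (truncation k C) = cmp_shell n C"
  by (intro ext; simp add: conn_shell_def cmp_shell_def split_beta)+

context cubical_omega
begin

lemma face_family_shell:
  assumes "A \<in> cells C (n + 1)"
  shows "face_family C (n + 1) A \<in> shells n (truncation n C)"
  using assms face_closed[of "n + 1" _ A] face_face_general[OF assms]
  by (auto simp: shells_def face_family_def)

text \<open>The faces prescribed for a connection of shells are those that the axioms give to a
  connection in C. With \<open>cmp_shell_eq\<close> this lets an equation between cells of C pass to
  their shells.\<close>

lemma conn_shell_eq: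
  assumes "A \<in> cells C n" "1 \<le> i" "i \<le> n"
  shows "conn_shell n C i \<alpha> A = face_family C (n + 1) (conn C n i \<alpha> A)"
  using assms
  by (intro ext) (auto simp: conn_shell_def face_family_def restrict_def face_conn_same
      face_conn_opposite face_conn)

lemma cmp_shell_eq:
  assumes "composable C (n + 1) i A B"
  shows "cmp_shell n C i (face_family C (n + 1) A) (face_family C (n + 1) B) =
    face_family C (n + 1) (cmp C (n + 1) i A B)"
proof (intro ext)
  fix p :: "nat \<times> sign"
  obtain m \<alpha> where p: "p = (m, \<alpha>)" by force
  show "cmp_shell n C i (face_family C (n + 1) A) (face_family C (n + 1) B) p =
    face_family C (n + 1) (cmp C (n + 1) i A B) p"
    using assms face_cmp[of "n + 1" m i A B \<alpha>]
      face_cmp_minus[of "n + 1" i A B] face_cmp_plus[of "n + 1" i A B]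
    by (cases \<alpha>) (auto simp: p cmp_shell_def face_family_def restrict_def)
qed

lemma T_equation_shell_if:
  assumes "is_T_inverse C (n + 1) i A B" "1 \<le> i" "i \<le> n"
  shows "T_equation_shell n C i (face_family C (n + 1) A) (face_family C (n + 1) B)"
proof -
  interpret P: cubical_plane C "n + 1" i
    rewrites "n + 1 - 1 = n" and "n + 1 - 2 = n - 1"
    using assms by (auto intro!: planeI)
  have AB: "P.transposed A B" "T_equation C (n + 1) i A B"
    using assms by (auto simp: P.is_T_inverse_iff P.T_equation_iff)
  note AB' = AB(1)[unfolded P.transposed_def]
  have ff: "face_family C (n + 1) A (i, \<alpha>) = face C (n + 1) i \<alpha> A"
    "face_family C (n + 1) A (i + 1, \<alpha>) = face C (n + 1) (i + 1) \<alpha> A" for \<alpha>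
    using assms by (auto simp: face_family_def)
  have cl: "face C (n + 1) i \<alpha> A \<in> cells C n" "face C (n + 1) (i + 1) \<alpha> A \<in> cells C n" for \<alpha>
    using AB' by (cases \<alpha>; simp)+
  show ?thesis
    using AB' AB(2) cl assms(2,3)
    by (simp add: T_equation_shell_def T_equation_def ff conn_shell_eq cmp_shell_eq composable_iff)
qed

lemma has_T_invertible_shell_if:
  assumes "T_invertible C (n + 1) i A" "1 \<le> i" "i \<le> n"
  shows "has_T_invertible_shell C (n + 1) i A"
proof -
  obtain B where B: "is_T_inverse C (n + 1) i A B" using assms by (auto simp: T_invertible_def)
  then have B': "is_T_inverse C (n + 1) i B A" by (auto simp: is_T_inverse_def)
  have "T_equation_shell n C i (face_family C (n + 1) A) (face_family C (n + 1) B)"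
    "T_equation_shell n C i (face_family C (n + 1) B) (face_family C (n + 1) A)"
    using T_equation_shell_if[OF B] T_equation_shell_if[OF B'] assms by auto
  then have "is_T_inverse (shell_category n (truncation n C)) (n + 1) i
     (shell_of C (n + 1) A) (shell_of C (n + 1) B)"
    using B assms(2,3) face_family_shell[of A n] face_family_shell[of B n]
    unfolding is_T_inverse_def shell_of_eq T_equation_shell_category
    by (auto simp: T_equation_shell_def face_family_def)
  then show ?thesis by (auto simp: has_T_invertible_shell_def T_invertible_def)
qed

text \<open>The inverse of the shell is a compatible family \<open>G\<close>, which need not be the
  shell of any cell. Its members \<open>G (m, \<alpha>)\<close> are T-inverses of the corresponding
  faces of \<open>A\<close>.\<close>

lemma T_faces_if_has_T_invertible_shell:
  assumes "has_T_invertible_shell C (n + 1) i A" "A \<in> cells C (n + 1)" "1 \<le> i" "i \<le> n"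
  shows "T_faces (n + 1) i A"
proof -
  let ?D = "shell_category n (truncation n C)" and ?F = "face_family C (n + 1) A"
  obtain S where S: "is_T_inverse ?D (n + 1) i (Shell ?F) S"
    using assms(1) by (auto simp: has_T_invertible_shell_def T_invertible_def shell_of_eq)
  then obtain G where G: "G \<in> shells n (truncation n C)" "S = Shell G"
    by (auto simp: is_T_inverse_def)
  have F: "?F \<in> shells n (truncation n C)" using assms(2) by (rule face_family_shell)
  have faces: "?F (i, \<beta>) = G (i + 1, \<beta>)" "?F (i + 1, \<beta>) = G (i, \<beta>)" for \<beta>
    using S by (auto simp: is_T_inverse_def G(2))
  have eqs: "T_equation_shell n (truncation n C) i ?F G" "T_equation_shell n (truncation n C) i G ?F"
    using S by (auto simp: is_T_inverse_def G(2) T_equation_shell_category)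
  have "is_T_inverse C n (down m i) (face C (n + 1) m \<alpha> A) (G (m, \<alpha>))"
    if m: "1 \<le> m" "m \<le> n + 1" "m \<noteq> i" "m \<noteq> i + 1" for m \<alpha>
  proof -
    have d: "down m (i + 1) = down m i + 1" "down (i + 1) m = down i m"
      using assms(3,4) m by (auto simp: down_def)
    have Fm: "?F (m, \<alpha>) = face C (n + 1) m \<alpha> A" using m by (simp add: face_family_def)
    have "T_equation (truncation n C) n (down m i) (?F (m, \<alpha>)) (G (m, \<alpha>))"
      "T_equation (truncation n C) n (down m i) (G (m, \<alpha>)) (?F (m, \<alpha>))"
      using T_equation_face_if_shell[OF eqs(1) F] T_equation_face_if_shell[OF eqs(2) G(1)] assms(3,4) m
      by auto
    moreover have "face C n (down m i) \<beta> (H (m, \<alpha>)) = face C n (down i m) \<alpha> (H (i, \<beta>))"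
      "face C n (down m i + 1) \<beta> (H (m, \<alpha>)) = face C n (down i m) \<alpha> (H (i + 1, \<beta>))"
      if "H \<in> shells n (truncation n C)" for H \<beta>
      using shell_face_face[OF that, of i m \<beta> \<alpha>] shell_face_face[OF that, of "i + 1" m \<beta> \<alpha>] assms(3,4) m
      by (simp_all add: d)
    moreover have "?F (m, \<alpha>) \<in> cells C n" "G (m, \<alpha>) \<in> cells C n"
      using F G(1) m by (auto simp: shells_def)
    ultimately have "is_T_inverse C n (down m i) (?F (m, \<alpha>)) (G (m, \<alpha>))"
      using F G(1) by (auto simp: is_T_inverse_def T_equation_def faces)
    then show ?thesis by (simp add: Fm)
  qed
  then show ?thesis
    using assms(2) by (auto simp: T_faces_def T_invertible_def)
qed

end

theorem proposition3p3p5: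
  fixes C :: "'a cubical_data" and n i :: nat and A :: 'a
  assumes "cubical_omega_category C"
    and "n \<ge> 2"
    and "A \<in> cells C n"
    and "1 \<le> i" and "i < n"
  shows "T_invertible C n i A \<longleftrightarrow> invertible_cell C n A \<and> has_T_invertible_shell C n i A"
proof -
  interpret cubical_omega C by (intro cubical_omega.intro assms(1))
  have n: "n - 1 + 1 = n" "i \<le> n - 1" using assms by auto
  have "has_T_invertible_shell C n i A" if "T_invertible C n i A"
    using has_T_invertible_shell_if[of "n - 1" i A] that assms n by simp
  \<comment> \<open>\<open>T_faces\<close> serves both implications: T_i-invertibility of
    \<open>A\<close> already gives a T_i-invertible shell, so in either case the comparison with
    \<open>invertible_cell\<close> applies.\<close>
  moreover have "T_faces n i A" if "has_T_invertible_shell C n i A"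
    using T_faces_if_has_T_invertible_shell[of "n - 1" i A] that assms n by simp
  ultimately show ?thesis
    using T_invertible_iff_invertible_cell[of n i A] assms by blast
qed

end
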